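(* Let $\Phi$ be the invariant $\mathrm{Spin}(7)$-structure on $G/H=(\mathrm{SU}(3)/\mathrm{SU}(2))\times\mathrm{SU}(2)$ given by $$\Phi=e^{1234}+e^{1256}-e^{1278}+e^{1357}+e^{1368}+e^{1458}-e^{1467}+e^{5678}+e^{3478}-e^{3456}+e^{2468}+e^{2457}-e^{2358}+e^{2367}.$$ Then the homogeneous space $G/H$ endowed with the metric $g=\sum_{i=1}^8e^i\otimes e^i$ induced by $\Phi$ is naturally reductive, and its canonical connection $\nabla^0$ coincides with the characteristic connection $\nabla$ of $\Phi$. In particular, the torsion of $\nabla$ is given by $$T=-\sqrt3\,(e^{125}-e^{345})+e^{678}$$ and it is $\nabla$-parallel.
   Context: Write $e^{i_1\cdots i_r}=e^{i_1}\wedge\cdots\wedge e^{i_r}$. A $\mathrm{Spin}(7)$-structure on an 8-manifold is a 4-form $\Phi$ (called admissible) such that at each point there is a basis of the cotangent space in which $\Phi$ takes the form displayed in the claim; it induces the Riemannian metric $g_\Phi$ for which such bases are orthonormal. The characteristic connection of $(M,\Phi)$ is the unique connection $\nabla$ that is metric for $g_\Phi$, has totally skew-symmetric torsion $T$, and satisfies $\nabla\Phi=0$; it is $\nabla=\nabla^{g_\Phi}+\frac12T$, with $\nabla^{g_\Phi}$ the Levi-Civita connection. The torsion is regarded as a 3-form by means of the metric. $G=\mathrm{SU}(3)\times\mathrm{SU}(2)$ and $H=\mathrm{SU}(2)\times\{e\}$, where $\mathrm{SU}(2)\subset\mathrm{SU}(3)$ is the stabilizer of $(1,0,0)\in\mathbb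 C^3$ (lower right $2\times2$ block). In $\mathfrak{su}(3)$ put, with $\mathcal{E}_{ab}$ the elementary $3\times3$ matrices, $e_1=-\mathcal{E}_{12}+\mathcal{E}_{21}$, $e_2=i(\mathcal{E}_{12}+\mathcal{E}_{21})$, $e_3=\mathcal{E}_{13}-\mathcal{E}_{31}$, $e_4=i(\mathcal{E}_{13}+\mathcal{E}_{31})$, $e_5=\frac1{\sqrt3}\mathrm{diag}(2i,-i,-i)$; in $\mathfrak{su}(2)$ put $e_6=-\frac12\begin{pmatrix}0&i\\ i&0\end{pmatrix}$, $e_7=\frac12\begin{pmatrix}0&-1\\1&0\end{pmatrix}$, $e_8=\frac12\begin{pmatrix}-i&0\\0&i\end{pmatrix}$, so that $[e_6,e_7]=e_8$, $[e_6,e_8]=-e_7$, $[e_7,e_8]=e_6$. Then, with $\mathfrak g$ and $\mathfrak h$ the Lie algebras of $G$ and $H$, $\mathfrak g=\mathfrak h\oplus\mathfrak m$ with $\mathfrak m=\mathrm{span}\{e_1,\dots,e_8\}$ is a reductive decomposition, $\mathfrak m$ is identified with the tangent space at $eH$, and $e^1,\dots,e^8$ is the dual basis. $G$-invariant tensors on $G/H$ are identified with $\mathrm{Ad}(H)$-invariant tensors on $\mathfrak m$. The homogeneous space with metric $g$ and decomposition $\mathfrak g=\mathfrak h\oplus\mathfrak m$ is naturally reductive if $g([X,Y]_{\mathfrak m},Z)$ is totally skew-symmetric in $X,Y,Z\in\mathfrak m$, where the subscript denotes the $\mathfrak m$-component. The canonical connection $\nabla^0$ is the $G$-invariant connection,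 associated with this reductive decomposition, whose Nomizu map $\mathfrak m\to\mathfrak{gl}(\mathfrak m)$ vanishes.
   Formalization: The tangent space at eH is identified with m by sending X to the velocity of exp(-tX)H; under the usual identification by exp(tX)H the torsion of the canonical connection is -[X,Y]_m, so the displayed T would hold with the opposite sign. *)

theory Defs
  imports "HOL-Analysis.Analysis" "HOL-Combinatorics.Permutations"
begin

section \<open>The groups and their Lie algebras\<close>

type_synonym mat_pair = "(complex^3^3) \<times> (complex^2^2)"

definition conj_transpose :: "complex^'n^'m \<Rightarrow> complex^'m^'n" where
  "conj_transpose A = (\<chi> i j. cnj (A $ j $ i))"

definition SU :: "(complex^'n^'n) set" where
  "SU = {A. conj_transpose A ** A = mat 1 \<and> det A = 1}"

definition su :: "(complex^'n^'n) set" where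
  "su = {X. conj_transpose X = - X \<and> trace X = 0}"

definition G :: "mat_pair set" where
  "G = SU \<times> SU"

definition H :: "mat_pair set" where
  "H = {(A, mat 1) | A. A \<in> SU \<and> A *v axis 1 1 = axis 1 1}"

definition lie_G :: "mat_pair set" where
  "lie_G = su \<times> su"

definition lie_H :: "mat_pair set" where
  "lie_H = {(X, 0) | X. X \<in> su \<and> X *v axis 1 1 = 0}"

definition gmul :: "mat_pair \<Rightarrow> mat_pair \<Rightarrow> mat_pair" where
  "gmul a b = (fst a ** fst b, snd a ** snd b)"

definition ginv :: "mat_pair \<Rightarrow> mat_pair" where
  "ginv a = (matrix_inv (fst a), matrix_inv (snd a))"

definition Ad :: "mat_pair \<Rightarrow> mat_pair \<Rightarrow> mat_pair" where
  "Ad a X = gmul (gmul a X) (ginv a)"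

definition bracket :: "mat_pair \<Rightarrow> mat_pair \<Rightarrow> mat_pair" where
  "bracket X Y = gmul X Y - gmul Y X"

definition elem_mat :: "3 \<Rightarrow> 3 \<Rightarrow> complex^3^3" where
  "elem_mat a b = (\<chi> i j. if i = a \<and> j = b then 1 else 0)"

definition cscale :: "complex \<Rightarrow> complex^'n^'m \<Rightarrow> complex^'n^'m" where
  "cscale c A = (\<chi> i j. c * A $ i $ j)"

text \<open>Only the indices \<open>1, \<dots>, 8\<close> are meaningful.\<close>

definition e :: "nat \<Rightarrow> mat_pair" where
  "e i =
    [(- elem_mat 1 2 + elem_mat 2 1, 0),
     (cscale \<i> (elem_mat 1 2 + elem_mat 2 1), 0),
     (elem_mat 1 3 - elem_mat 3 1, 0),
     (cscale \<i> (elem_mat 1 3 + elem_mat 3 1), 0),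
     ((1 / sqrt 3) *\<^sub>R vector [vector [2 * \<i>, 0, 0], vector [0, - \<i>, 0], vector [0, 0, - \<i>]], 0),
     (0, (- 1 / 2) *\<^sub>R vector [vector [0, \<i>], vector [\<i>, 0]]),
     (0, (1 / 2) *\<^sub>R vector [vector [0, - 1], vector [1, 0]]),
     (0, (1 / 2) *\<^sub>R vector [vector [- \<i>, 0], vector [0, \<i>]])] ! (i - 1)"

definition \<mm> :: "mat_pair set" where
  "\<mm> = span (e ` {1..8})"

definition m_part :: "mat_pair \<Rightarrow> mat_pair" where
  "m_part X = (THE Y. Y \<in> \<mm> \<and> X - Y \<in> lie_H)"


section \<open>Multilinear forms on \<open>\<mm>\<close>\<close>

text \<open>An \<open>r\<close>-linear form is a function of a list of \<open>r\<close> vectors.  The wedge product of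
  one-forms follows the determinant convention, so \<open>e\<^sup>1\<^sup>2\<^sup>3(e\<^sub>1, e\<^sub>2, e\<^sub>3) = 1\<close>.\<close>

type_synonym form = "mat_pair list \<Rightarrow> real"

definition frame :: "(nat \<Rightarrow> mat_pair) \<Rightarrow> bool" where
  "frame b \<longleftrightarrow> inj_on b {1..8} \<and> independent (b ` {1..8}) \<and> span (b ` {1..8}) = \<mm>"

definition dual :: "(nat \<Rightarrow> mat_pair) \<Rightarrow> nat \<Rightarrow> mat_pair \<Rightarrow> real" where
  "dual b i X = representation (b ` {1..8}) X (b i)"

definition wedge :: "(nat \<Rightarrow> mat_pair \<Rightarrow> real) \<Rightarrow> nat list \<Rightarrow> form" where
  "wedge \<theta> is vs =
    (\<Sum>p | p permutes {..<length is}.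
       of_int (sign p) * (\<Prod>k<length is. \<theta> (is ! k) (vs ! p k)))"

definition spin7_normal_form :: "(nat \<Rightarrow> mat_pair \<Rightarrow> real) \<Rightarrow> form" where
  "spin7_normal_form \<theta> vs =
     wedge \<theta> [1,2,3,4] vs + wedge \<theta> [1,2,5,6] vs - wedge \<theta> [1,2,7,8] vs
   + wedge \<theta> [1,3,5,7] vs + wedge \<theta> [1,3,6,8] vs + wedge \<theta> [1,4,5,8] vs
   - wedge \<theta> [1,4,6,7] vs + wedge \<theta> [5,6,7,8] vs + wedge \<theta> [3,4,7,8] vs
   - wedge \<theta> [3,4,5,6] vs + wedge \<theta> [2,4,6,8] vs + wedge \<theta> [2,4,5,7] vs
   - wedge \<theta> [2,3,5,8] vs + wedge \<theta> [2,3,6,7] vs"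

definition \<Phi> :: form where
  "\<Phi> = spin7_normal_form (dual e)"

definition std_metric :: form where
  "std_metric vs = (\<Sum>i\<in>{1..8}. dual e i (vs ! 0) * dual e i (vs ! 1))"

definition torsion_3form :: form where
  "torsion_3form vs =
     - sqrt 3 * (wedge (dual e) [1,2,5] vs - wedge (dual e) [3,4,5] vs) + wedge (dual e) [6,7,8] vs"

definition Ad_H_invariant :: "nat \<Rightarrow> form \<Rightarrow> bool" where
  "Ad_H_invariant r \<phi> \<longleftrightarrow>
     (\<forall>h\<in>H. \<forall>vs. length vs = r \<and> set vs \<subseteq> \<mm> \<longrightarrow> \<phi> (map (Ad h) vs) = \<phi> vs)"

text \<open>The coframes of \<open>\<mm>\<close> are exactly the duals of frames.  By invariance it suffices to
  ask for an admissible coframe at the origin.\<close>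

definition invariant_spin7_structure :: "form \<Rightarrow> bool" where
  "invariant_spin7_structure \<phi> \<longleftrightarrow>
     Ad_H_invariant 4 \<phi> \<and>
     (\<exists>b. frame b \<and>
        (\<forall>vs. length vs = 4 \<and> set vs \<subseteq> \<mm> \<longrightarrow> \<phi> vs = spin7_normal_form (dual b) vs))"

definition induced_metric :: "form \<Rightarrow> form \<Rightarrow> bool" where
  "induced_metric \<phi> g \<longleftrightarrow>
     (\<exists>b. frame b \<and>
        (\<forall>vs. length vs = 4 \<and> set vs \<subseteq> \<mm> \<longrightarrow> \<phi> vs = spin7_normal_form (dual b) vs) \<and>
        (\<forall>X\<in>\<mm>. \<forall>Y\<in>\<mm>. g [X, Y] = (\<Sum>i\<in>{1..8}. dual b i X * dual b i Y)))"

definition reductive_decomposition :: bool where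
  "reductive_decomposition \<longleftrightarrow>
     \<mm> \<subseteq> lie_G \<and> lie_H \<inter> \<mm> = {0} \<and> (\<forall>Z\<in>lie_G. \<exists>X\<in>lie_H. \<exists>Y\<in>\<mm>. Z = X + Y) \<and>
     (\<forall>h\<in>H. Ad h ` \<mm> \<subseteq> \<mm>)"

definition naturally_reductive :: "form \<Rightarrow> bool" where
  "naturally_reductive g \<longleftrightarrow>
     reductive_decomposition \<and> Ad_H_invariant 2 g \<and>
     (\<forall>X\<in>\<mm>. \<forall>Y\<in>\<mm>. \<forall>Z\<in>\<mm>.
        g [m_part (bracket X Y), Z] = - g [m_part (bracket Y X), Z] \<and>
        g [m_part (bracket X Y), Z] = - g [m_part (bracket X Z), Y])"


section \<open>Smooth functions and vector fields on \<open>G/H\<close>\<close>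

primrec Ck_on :: "nat \<Rightarrow> 'a::euclidean_space set \<Rightarrow> ('a \<Rightarrow> 'b::euclidean_space) \<Rightarrow> bool" where
  "Ck_on 0 U f \<longleftrightarrow> continuous_on U f"
| "Ck_on (Suc k) U f \<longleftrightarrow>
     (\<forall>x\<in>U. f differentiable at x) \<and> (\<forall>v. Ck_on k U (\<lambda>x. frechet_derivative f (at x) v))"

text \<open>Smoothness on the submanifold \<open>G\<close> of the space of matrix pairs.\<close>

definition smooth_G :: "(mat_pair \<Rightarrow> 'b::euclidean_space) \<Rightarrow> bool" where
  "smooth_G f \<longleftrightarrow>
     (\<exists>U F. open U \<and> G \<subseteq> U \<and> (\<forall>k. Ck_on k U F) \<and> (\<forall>a\<in>G. F a = f a))"

text \<open>A function on \<open>G/H\<close> is a right \<open>H\<close>-invariant function on \<open>G\<close>, and a vector field on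
  \<open>G/H\<close>, that is a section of the tangent bundle \<open>G \<times>\<^sub>H \<mm>\<close>, is an \<open>H\<close>-equivariant function
  from \<open>G\<close> to \<open>\<mm>\<close>.  All such functions are extended by zero outside \<open>G\<close>.\<close>

definition smooth_functions :: "(mat_pair \<Rightarrow> real) set" where
  "smooth_functions = {f. smooth_G f \<and> (\<forall>a. a \<notin> G \<longrightarrow> f a = 0) \<and> (\<forall>a\<in>G. \<forall>h\<in>H. f (gmul a h) = f a)}"

definition vector_fields :: "(mat_pair \<Rightarrow> mat_pair) set" where
  "vector_fields = {X. smooth_G X \<and> (\<forall>a. a \<notin> G \<longrightarrow> X a = 0) \<and> (\<forall>a\<in>G. X a \<in> \<mm>) \<and>
     (\<forall>a\<in>G. \<forall>h\<in>H. X (gmul a h) = Ad (ginv h) (X a))}"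

text \<open>The space \<open>\<mm>\<close> is identified with the tangent space at \<open>eH\<close> by means of fundamental
  vector fields, normalised so that they give a Lie algebra homomorphism from \<open>\<gg>\<close> to the
  vector fields on \<open>G/H\<close>: the vector \<open>X\<close> corresponds to the velocity of \<open>exp(- t X) H\<close> at
  \<open>t = 0\<close>.  The tangent space at \<open>aH\<close> is reached from there by the left translation by
  \<open>a\<close>, hence the horizontal lift of a vector field \<open>X\<close> to \<open>G\<close> is \<open>a \<mapsto> - a X(a)\<close>.  The
  opposite identification changes the sign of every invariant tensor of odd degree when it is
  expressed on \<open>\<mm>\<close>; in particular it changes the sign of the torsion, but not of the metric
  or of an invariant four-form.\<close>

definition lift :: "(mat_pair \<Rightarrow> mat_pair) \<Rightarrow> mat_pair \<Rightarrow> mat_pair" where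
  "lift X a = - gmul a (X a)"

text \<open>The derivative of a function on \<open>G\<close> along the horizontal lift of \<open>X\<close>.  The derivative
  within \<open>G\<close> is not unique as a linear map on the space of matrix pairs, but its value on
  vectors tangent to \<open>G\<close> is.\<close>

definition along ::
  "(mat_pair \<Rightarrow> mat_pair) \<Rightarrow> (mat_pair \<Rightarrow> 'b::euclidean_space) \<Rightarrow> mat_pair \<Rightarrow> 'b" where
  "along X f a = frechet_derivative f (at a within G) (lift X a)"

text \<open>The bracket of two vector fields on \<open>G/H\<close> is the projection of the bracket of their
  horizontal lifts, which is the usual bracket of matrix-valued functions; the outer minus sign
  undoes the one in \<^const>\<open>lift\<close>.\<close>

definition lie_bracket ::
  "(mat_pair \<Rightarrow> mat_pair) \<Rightarrow> (mat_pair \<Rightarrow> mat_pair) \<Rightarrow> mat_pair \<Rightarrow> mat_pair" where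
  "lie_bracket X Y a =
     (if a \<in> G then - m_part (gmul (ginv a) (along X (lift Y) a - along Y (lift X) a)) else 0)"


section \<open>Connections\<close>

type_synonym connection =
  "(mat_pair \<Rightarrow> mat_pair) \<Rightarrow> (mat_pair \<Rightarrow> mat_pair) \<Rightarrow> mat_pair \<Rightarrow> mat_pair"

text \<open>Only the values of a connection on vector fields are relevant.\<close>

definition is_connection :: "connection \<Rightarrow> bool" where
  "is_connection D \<longleftrightarrow>
     (\<forall>X\<in>vector_fields. \<forall>Y\<in>vector_fields. D X Y \<in> vector_fields) \<and>
     (\<forall>X\<in>vector_fields. \<forall>X'\<in>vector_fields. \<forall>Y\<in>vector_fields.
        D (\<lambda>a. X a + X' a) Y = (\<lambda>a. D X Y a + D X' Y a)) \<and>
     (\<forall>X\<in>vector_fields. \<forall>Y\<in>vector_fields. \<forall>Y'\<in>vector_fields.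
        D X (\<lambda>a. Y a + Y' a) = (\<lambda>a. D X Y a + D X Y' a)) \<and>
     (\<forall>f\<in>smooth_functions. \<forall>X\<in>vector_fields. \<forall>Y\<in>vector_fields.
        D (\<lambda>a. f a *\<^sub>R X a) Y = (\<lambda>a. f a *\<^sub>R D X Y a)) \<and>
     (\<forall>f\<in>smooth_functions. \<forall>X\<in>vector_fields. \<forall>Y\<in>vector_fields.
        D X (\<lambda>a. f a *\<^sub>R Y a) = (\<lambda>a. along X f a *\<^sub>R Y a + f a *\<^sub>R D X Y a))"

text \<open>A covariant tensor field is a function of a list of vector fields.\<close>

type_synonym tensor_field = "(mat_pair \<Rightarrow> mat_pair) list \<Rightarrow> mat_pair \<Rightarrow> real"

definition invariant_tensor :: "form \<Rightarrow> tensor_field" where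
  "invariant_tensor \<phi> Xs a = \<phi> (map (\<lambda>X. X a) Xs)"

definition cov_deriv ::
  "connection \<Rightarrow> (mat_pair \<Rightarrow> mat_pair) \<Rightarrow> tensor_field \<Rightarrow> tensor_field" where
  "cov_deriv D W S Xs a = along W (S Xs) a - (\<Sum>i<length Xs. S (Xs[i := D W (Xs ! i)]) a)"

definition parallel :: "connection \<Rightarrow> nat \<Rightarrow> tensor_field \<Rightarrow> bool" where
  "parallel D r S \<longleftrightarrow>
     (\<forall>W\<in>vector_fields. \<forall>Xs. length Xs = r \<and> set Xs \<subseteq> vector_fields \<longrightarrow>
        (\<forall>a\<in>G. cov_deriv D W S Xs a = 0))"

definition torsion ::
  "connection \<Rightarrow> (mat_pair \<Rightarrow> mat_pair) \<Rightarrow> (mat_pair \<Rightarrow> mat_pair) \<Rightarrow> mat_pair \<Rightarrow> mat_pair" where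
  "torsion D X Y a = D X Y a - D Y X a - lie_bracket X Y a"

definition torsion_tensor :: "form \<Rightarrow> connection \<Rightarrow> tensor_field" where
  "torsion_tensor g D Xs a = g [torsion D (Xs ! 0) (Xs ! 1) a, (Xs ! 2) a]"

definition skew_torsion :: "form \<Rightarrow> connection \<Rightarrow> bool" where
  "skew_torsion g D \<longleftrightarrow>
     (\<forall>X\<in>vector_fields. \<forall>Y\<in>vector_fields. \<forall>Z\<in>vector_fields. \<forall>a\<in>G.
        torsion_tensor g D [X, Y, Z] a = - torsion_tensor g D [Y, X, Z] a \<and>
        torsion_tensor g D [X, Y, Z] a = - torsion_tensor g D [X, Z, Y] a)"

definition characteristic_connection :: "form \<Rightarrow> form \<Rightarrow> connection \<Rightarrow> bool" where
  "characteristic_connection \<phi> g D \<longleftrightarrow>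
     is_connection D \<and> parallel D 2 (invariant_tensor g) \<and> skew_torsion g D \<and>
     parallel D 4 (invariant_tensor \<phi>)"

text \<open>The invariant connection with Nomizu map \<open>\<Lambda>\<close>; as everywhere, the arguments of \<open>\<Lambda>\<close>
  are tangent vectors under the above identification.\<close>

definition nomizu_connection :: "(mat_pair \<Rightarrow> mat_pair \<Rightarrow> mat_pair) \<Rightarrow> connection" where
  "nomizu_connection \<Lambda> X Y a = (if a \<in> G then along X Y a + \<Lambda> (X a) (Y a) else 0)"

definition canonical_connection :: connection where
  "canonical_connection = nomizu_connection (\<lambda>X Y. 0)"

end

theory Submission
  imports Defs
begin

text \<open>
  Read on \<open>G\<close>, the canonical connection is the plain derivative along the horizontal lift, so
  every tensor with constant coefficients is parallel for it, and its torsion at \<open>a\<close> is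
  \<open>[X a, Y a]\<^sub>\<mm>\<close>.  The form \<open>\<Phi>\<close> equals
  \<open>e\<^sup>1\<^sup>2\<^sup>3\<^sup>4 + \<omega>\<^sub>1 \<and> (e\<^sup>5\<^sup>6 - e\<^sup>7\<^sup>8) + \<omega>\<^sub>2 \<and> (e\<^sup>5\<^sup>7 + e\<^sup>6\<^sup>8) + \<omega>\<^sub>3 \<and> (e\<^sup>5\<^sup>8 - e\<^sup>6\<^sup>7) + e\<^sup>5\<^sup>6\<^sup>7\<^sup>8\<close>,
  where \<open>e\<^sup>1\<^sup>2\<^sup>3\<^sup>4 = - \<omega>\<^sub>1 \<and> \<omega>\<^sub>1 / 2\<close> and \<open>\<omega>\<^sub>1, \<omega>\<^sub>2, \<omega>\<^sub>3\<close> are the imaginary part of the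
  Hermitian product and the components of the complex area form on the first column, which are
  preserved by \<open>SU(2)\<close>.  For uniqueness, the difference of two characteristic connections is a
  three-form whose contraction with any vector lies in \<open>spin(7)\<close>; such a form vanishes.
\<close>

section \<open>The group and its adjoint action\<close>

text \<open>Two obstacles shape the proof. A derivative within \<open>G\<close> is determined only
  in directions tangent to \<open>G\<close>, while \<open>m_part\<close> and \<open>dual\<close> are
  meaningful only on the Lie algebra and on \<open>\<mm>\<close>. Each such operation is therefore
  replaced by a map that is linear on all matrix pairs: \<open>star\<close> for the inverse,
  \<open>coord\<close> for the dual basis, \<open>proj\<close> for the projection to
  \<open>\<mm>\<close>. These maps can be differentiated freely and agree with the originals where
  those are meaningful. Secondly, the constant functions with values \<open>e 1\<close>, ...,
  \<open>e 4\<close> are not \<open>H\<close>-equivariant, hence not vector fields, so two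
  connections cannot be compared in a constant frame. They are compared at one point, on global
  fields that take the values \<open>e i\<close> there. That the difference at a point depends only
  on the values of its arguments at that point follows from a finite set of global generators of the
  module of vector fields.\<close>

lemma conj_transpose_nth [simp]: "conj_transpose A $ i $ j = cnj (A $ j $ i)"
  by (simp add: conj_transpose_def)

lemma conj_transpose_conj_transpose [simp]: "conj_transpose (conj_transpose A) = A"
  by (simp add: vec_eq_iff)

lemma conj_transpose_mult: "conj_transpose (A ** B) = conj_transpose B ** conj_transpose A"
  by (simp add: vec_eq_iff matrix_matrix_mult_def mult.commute)

lemma conj_transpose_mat_1 [simp]: "conj_transpose (mat 1) = mat 1"
  by (simp add: vec_eq_iff mat_def)

lemma linear_conj_transpose: "linear conj_transpose"
  by (rule linearI) (simp_all add: vec_eq_iff)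

lemma det_conj_transpose: "det (conj_transpose A) = cnj (det A)"
proof -
  have "det (conj_transpose A) = det (transpose (conj_transpose A))"
    by (simp add: det_transpose)
  also have "\<dots> = cnj (det A)"
    by (simp add: det_def transpose_def)
  finally show ?thesis .
qed

text \<open>This is the inverse on \<open>G\<close>, but it is linear on the whole space of matrix
  pairs, so it is smooth without any discussion of matrix inversion.\<close>

definition star :: "mat_pair \<Rightarrow> mat_pair" where
  "star a = (conj_transpose (fst a), conj_transpose (snd a))"

definition gone :: mat_pair where
  "gone = (mat 1, mat 1)"

lemma star_star [simp]: "star (star a) = a"
  by (simp add: star_def)

lemma star_gmul: "star (gmul a b) = gmul (star b) (star a)"
  by (simp add: star_def gmul_def conj_transpose_mult)

lemma linear_star: "linear star"
  by (rule linearI) (simp_all add: star_def linear_add[OF linear_conj_transpose] linear_scale[OF linear_conj_transpose])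

lemma gmul_assoc: "gmul (gmul a b) c = gmul a (gmul b c)"
  by (simp add: gmul_def matrix_mul_assoc)

lemma gmul_gone [simp]: "gmul gone a = a" "gmul a gone = a"
  by (simp_all add: gmul_def gone_def)

lemma bounded_bilinear_gmul: "bounded_bilinear gmul"
proof -
  have "bilinear gmul"
    unfolding bilinear_def
  proof (intro conjI allI linearI)
    fix r :: real and x b1 b2
    show "gmul x (b1 + b2) = gmul x b1 + gmul x b2" "gmul (b1 + b2) x = gmul b1 x + gmul b2 x"
      by (simp_all add: gmul_def vec_eq_iff matrix_matrix_mult_def sum.distrib algebra_simps)
    show "gmul x (r *\<^sub>R b1) = r *\<^sub>R gmul x b1" "gmul (r *\<^sub>R b1) x = r *\<^sub>R gmul b1 x"
      by (simp_all add: gmul_def vec_eq_iff matrix_matrix_mult_def scaleR_sum_right)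
  qed
  then show ?thesis
    by (simp add: bilinear_conv_bounded_bilinear)
qed

interpretation gmul: bounded_bilinear gmul
  by (rule bounded_bilinear_gmul)

lemma star_simps [simp]:
  "star (a + b) = star a + star b" "star (a - b) = star a - star b" "star (- a) = - star a" "star 0 = 0"
  "star (r *\<^sub>R a) = r *\<^sub>R star a"
  by (simp_all add: linear_add linear_diff linear_neg linear_0 linear_scale linear_star)

lemma matrix_inv_SU:
  assumes "A \<in> SU"
  shows "matrix_inv A = conj_transpose A" "A ** conj_transpose A = mat 1" "conj_transpose A \<in> SU"
proof -
  have 1: "conj_transpose A ** A = mat 1"
    using assms by (simp add: SU_def)
  then show 2: "A ** conj_transpose A = mat 1"
    using matrix_left_right_inverse by blast
  have "A ** matrix_inv A = mat 1"
    unfolding matrix_inv_def by (rule someI2[of _ "conj_transpose A"]) (use 1 2 in auto)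
  then have "conj_transpose A ** (A ** matrix_inv A) = conj_transpose A"
    by simp
  then show "matrix_inv A = conj_transpose A"
    unfolding matrix_mul_assoc 1 by simp
  show "conj_transpose A \<in> SU"
    using assms 2 by (simp add: SU_def det_conj_transpose)
qed

lemma SU_mult:
  assumes "A \<in> SU" "B \<in> SU"
  shows "A ** B \<in> SU"
proof -
  have "conj_transpose (A ** B) ** (A ** B) = conj_transpose B ** ((conj_transpose A ** A) ** B)"
    by (simp only: conj_transpose_mult matrix_mul_assoc)
  also have "\<dots> = mat 1"
    using assms by (simp add: SU_def)
  finally show ?thesis
    using assms by (simp add: SU_def det_mul)
qed

lemma mat_1_SU [simp]: "mat 1 \<in> SU"
  by (simp add: SU_def)

lemma
  assumes "a \<in> G"
  shows ginv_eq_star: "ginv a = star a"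
    and gmul_star_left: "gmul (star a) a = gone"
    and gmul_star_right: "gmul a (star a) = gone"
    and star_in_G: "star a \<in> G"
  using assms matrix_inv_SU[of "fst a"] matrix_inv_SU[of "snd a"]
  by (auto simp: G_def ginv_def star_def gmul_def gone_def SU_def)

lemma gmul_in_G: "a \<in> G \<Longrightarrow> b \<in> G \<Longrightarrow> gmul a b \<in> G"
  by (auto simp: G_def gmul_def SU_mult)

lemma H_subset_G: "H \<subseteq> G"
  by (auto simp: H_def G_def)

lemma gmul_star_cancel:
  assumes "a \<in> G"
  shows "gmul a (gmul (star a) x) = x" "gmul (star a) (gmul a x) = x"
  using assms by (simp_all add: gmul_assoc[symmetric] gmul_star_left gmul_star_right)

lemma star_in_H:
  assumes "h \<in> H"
  shows "star h \<in> H"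
proof -
  obtain A where A: "h = (A, mat 1)" "A \<in> SU" "A *v axis 1 1 = axis 1 1"
    using assms by (auto simp: H_def)
  have "conj_transpose A *v axis 1 1 = conj_transpose A *v (A *v axis 1 1)"
    using A by simp
  also have "\<dots> = axis 1 1"
    using A(2) by (simp add: matrix_vector_mul_assoc SU_def)
  finally show ?thesis
    using A matrix_inv_SU[of A] by (simp add: star_def H_def)
qed

text \<open>The adjoint action with \<open>star\<close> in place of the inverse. Multiplicativity
  and the adjointness relation \<open>inner_ad\<close> then hold for all matrix pairs, not only on
  \<open>G\<close>.\<close>

definition ad :: "mat_pair \<Rightarrow> mat_pair \<Rightarrow> mat_pair" where
  "ad a x = gmul (gmul a x) (star a)"

lemma Ad_eq_ad: "a \<in> G \<Longrightarrow> Ad a = ad a"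
  by (simp add: Ad_def ad_def ginv_eq_star fun_eq_iff)

lemma linear_ad: "linear (ad a)"
  by (rule linearI) (simp_all add: ad_def gmul.add_left gmul.add_right gmul.scaleR_left gmul.scaleR_right)

lemma ad_gmul: "ad (gmul a b) x = ad a (ad b x)"
  by (simp add: ad_def star_gmul gmul_assoc)

lemma ad_star_cancel:
  assumes "a \<in> G"
  shows "ad a (ad (star a) x) = x" "ad (star a) (ad a x) = x"
  using assms gmul_star_cancel[OF assms] by (simp_all add: ad_def gmul_assoc gmul_star_left gmul_star_right)

section \<open>The trace inner product and the adjoint action\<close>

lemma inner_eq_trace: "A \<bullet> B = Re (trace (conj_transpose A ** B))" for A B :: "complex^'n^'m"
proof -
  have "A \<bullet> B = (\<Sum>i\<in>UNIV. \<Sum>j\<in>UNIV. Re (cnj (A $ i $ j) * B $ i $ j))"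
    by (simp add: inner_vec_def inner_complex_def)
  also have "\<dots> = (\<Sum>j\<in>UNIV. \<Sum>i\<in>UNIV. Re (cnj (A $ i $ j) * B $ i $ j))"
    by (rule sum.swap)
  finally show ?thesis
    by (simp add: trace_def matrix_matrix_mult_def)
qed

lemma inner_matrix_mult_left: "(A ** X) \<bullet> Y = X \<bullet> (conj_transpose A ** Y)" for A X Y :: "complex^'n^'n"
  unfolding inner_eq_trace conj_transpose_mult matrix_mul_assoc ..

lemma inner_matrix_mult_right: "(X ** A) \<bullet> Y = X \<bullet> (Y ** conj_transpose A)" for A X Y :: "complex^'n^'n"
proof -
  have "trace (conj_transpose A ** (conj_transpose X ** Y)) = trace ((conj_transpose X ** Y) ** conj_transpose A)"
    by (rule trace_mul_sym)
  then show ?thesis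
    unfolding inner_eq_trace conj_transpose_mult matrix_mul_assoc by (rule arg_cong)
qed

text \<open>Left and right multiplication by a matrix have multiplication by its conjugate transpose
  as adjoint. For \<open>a\<close> in \<open>G\<close>, where \<open>star a\<close> is the inverse,
  the adjoint action is thus orthogonal; this is what later makes \<open>\<mm>\<close> invariant
  without a matrix computation.\<close>

lemma inner_ad: "ad a X \<bullet> Y = X \<bullet> ad (star a) Y"
proof -
  have "gmul a X \<bullet> Y = X \<bullet> gmul (star a) Y" for a X Y
    by (simp add: gmul_def star_def inner_prod_def inner_matrix_mult_left)
  moreover have "gmul X a \<bullet> Y = X \<bullet> gmul Y (star a)" for a X Y
    by (simp add: gmul_def star_def inner_prod_def inner_matrix_mult_right)
  ultimately show ?thesis
    unfolding ad_def star_star by (metis gmul_assoc star_star)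
qed

section \<open>The Lie algebras of \<open>G\<close> and \<open>H\<close>\<close>

lemma trace_scaleR: "trace (r *\<^sub>R A) = r *\<^sub>R trace (A :: complex^'n^'n)"
  by (simp add: trace_def scaleR_sum_right)

lemma subspace_su: "subspace (su :: (complex^'n^'n) set)"
  by (rule subspaceI) (auto simp: su_def linear_0 linear_add linear_scale linear_conj_transpose trace_add trace_scaleR trace_0[unfolded mat_0])

lemma subspace_lie_G: "subspace lie_G"
  unfolding lie_G_def by (rule subspace_Times[OF subspace_su subspace_su])

lemma lie_G_iff: "x \<in> lie_G \<longleftrightarrow> star x = - x \<and> trace (fst x) = 0 \<and> trace (snd x) = 0"
  by (cases x) (auto simp: lie_G_def su_def star_def)

lemma lie_H_iff: "x \<in> lie_H \<longleftrightarrow> x \<in> lie_G \<and> snd x = 0 \<and> fst x *v axis 1 1 = 0"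
  by (cases x) (auto simp: lie_G_def lie_H_def subspace_0[OF subspace_su])

lemma subspace_lie_H: "subspace lie_H"
proof -
  have "(r *\<^sub>R A) *v axis 1 1 = r *\<^sub>R (A *v axis 1 1)" for r and A :: "complex^3^3"
    by (simp add: vec_eq_iff matrix_vector_mult_def scaleR_sum_right)
  then show ?thesis
    using subspace_lie_G unfolding subspace_def
    by (auto simp: lie_H_iff matrix_vector_mult_add_rdistrib)
qed

lemma trace_commutator: "trace (A ** B - B ** A) = 0" for A B :: "complex^'n^'n"
  using trace_mul_sym[of A B] by (simp add: trace_sub)

lemma bracket_lie_G:
  assumes "x \<in> lie_G" "y \<in> lie_G"
  shows "bracket x y \<in> lie_G"
  using assms by (simp add: lie_G_iff bracket_def star_gmul gmul.minus_left gmul.minus_right)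
    (simp add: gmul_def trace_commutator)

lemma trace_conj_SU:
  assumes "A \<in> SU"
  shows "trace (A ** X ** conj_transpose A) = trace X"
proof -
  have "trace (A ** X ** conj_transpose A) = trace (conj_transpose A ** (A ** X))"
    by (rule trace_mul_sym)
  then show ?thesis
    using assms by (simp add: matrix_mul_assoc SU_def)
qed

lemma ad_lie_G:
  assumes "a \<in> G" "x \<in> lie_G"
  shows "ad a x \<in> lie_G"
  using assms by (auto simp: lie_G_iff ad_def star_gmul gmul.minus_left gmul.minus_right gmul_assoc)
    (auto simp: G_def gmul_def star_def matrix_mul_assoc trace_conj_SU)

lemma ad_lie_H:
  assumes "h \<in> H" "x \<in> lie_H"
  shows "ad h x \<in> lie_H"
proof -
  have 1: "ad h x \<in> lie_G"
    using assms H_subset_G ad_lie_G lie_H_iff by blast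
  obtain A where A: "star h = (A, mat 1)" "A *v axis 1 1 = axis 1 1"
    using star_in_H[OF assms(1)] by (auto simp: H_def)
  show ?thesis
    using 1 A assms(2) by (auto simp: lie_H_iff ad_def gmul_def simp flip: matrix_vector_mul_assoc)
qed

section \<open>The reductive decomposition\<close>

text \<open>Keeps the index \<open>1\<close> in \<open>e 1\<close> and \<open>{1..8}\<close> from being rewritten to \<open>Suc 0\<close>.\<close>

declare One_nat_def [simp del]

lemma atLeastAtMost_1_8: "{1..8::nat} = {1,2,3,4,5,6,7,8}"
  by auto

lemma sum_1_8: "(\<Sum>i\<in>{1..8::nat}. f i) = f 1 + f 2 + f 3 + f 4 + f 5 + f 6 + f 7 + f 8"
  for f :: "nat \<Rightarrow> 'a::comm_monoid_add"
  unfolding atLeastAtMost_1_8 by (simp add: add.assoc)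

lemma e_matrices:
  "e 1 = (vector [vector [0, - 1, 0], vector [1, 0, 0], vector [0, 0, 0]], 0)"
  "e 2 = (vector [vector [0, \<i>, 0], vector [\<i>, 0, 0], vector [0, 0, 0]], 0)"
  "e 3 = (vector [vector [0, 0, 1], vector [0, 0, 0], vector [- 1, 0, 0]], 0)"
  "e 4 = (vector [vector [0, 0, \<i>], vector [0, 0, 0], vector [\<i>, 0, 0]], 0)"
  "e 5 = ((1 / sqrt 3) *\<^sub>R vector [vector [2 * \<i>, 0, 0], vector [0, - \<i>, 0], vector [0, 0, - \<i>]], 0)"
  "e 6 = (0, (- 1 / 2) *\<^sub>R vector [vector [0, \<i>], vector [\<i>, 0]])"
  "e 7 = (0, (1 / 2) *\<^sub>R vector [vector [0, - 1], vector [1, 0]])"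
  "e 8 = (0, (1 / 2) *\<^sub>R vector [vector [- \<i>, 0], vector [0, \<i>]])"
  by (simp_all add: e_def elem_mat_def cscale_def vec_eq_iff forall_3)

lemma inner_e:
  assumes "i \<in> {1..8}" "j \<in> {1..8}"
  shows "e i \<bullet> e j = (if i \<noteq> j then 0 else if i \<le> 5 then 2 else 1 / 2)"
  using assms unfolding atLeastAtMost_1_8
  by (elim insertE emptyE; simp add: e_matrices inner_prod_def inner_vec_def sum_3 sum_2 inner_complex_def)

text \<open>The basis is orthogonal for the ambient product but has squared norms 2 and 1/2, hence
  the denominator. Unlike \<open>dual e i\<close>, which is zero off the span of the basis, this
  functional is linear on all matrix pairs and can be differentiated.\<close>

definition coord :: "nat \<Rightarrow> mat_pair \<Rightarrow> real" where
  "coord i x = (x \<bullet> e i) / (e i \<bullet> e i)"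

lemma bounded_linear_coord: "bounded_linear (coord i)"
  unfolding coord_def
  by (rule bounded_linear_compose[OF bounded_linear_divide bounded_linear_inner_left])

lemmas coord_simps = linear_0[OF bounded_linear.linear[OF bounded_linear_coord]]
  linear_add[OF bounded_linear.linear[OF bounded_linear_coord]]
  linear_diff[OF bounded_linear.linear[OF bounded_linear_coord]]
  linear_neg[OF bounded_linear.linear[OF bounded_linear_coord]]
  linear_scale[OF bounded_linear.linear[OF bounded_linear_coord]]
  linear_sum[OF bounded_linear.linear[OF bounded_linear_coord]]

lemma coord_e:
  assumes "i \<in> {1..8}" "j \<in> {1..8}"
  shows "coord i (e j) = (if i = j then 1 else 0)"
  using inner_e[OF assms] inner_e[OF assms(1,1)] by (auto simp: coord_def inner_commute)

text \<open>The orthogonal projection of all matrix pairs onto \<open>\<mm>\<close>. On the Lie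
  algebra of \<open>G\<close> it turns out to be \<open>m_part\<close>.\<close>

definition proj :: "mat_pair \<Rightarrow> mat_pair" where
  "proj x = (\<Sum>i\<in>{1..8}. coord i x *\<^sub>R e i)"

lemma bounded_linear_proj: "bounded_linear proj"
  unfolding proj_def
  by (intro Real_Vector_Spaces.bounded_linear_sum bounded_linear_scaleR_left[THEN bounded_linear_compose] bounded_linear_coord)

lemmas linear_proj = bounded_linear.linear[OF bounded_linear_proj]

lemma subspace_m: "subspace \<mm>"
  by (simp add: \<mm>_def)

lemma e_in_m [simp]: "i \<in> {1..8} \<Longrightarrow> e i \<in> \<mm>"
  by (auto simp: \<mm>_def intro: span_base)

lemma proj_in_m [simp]: "proj x \<in> \<mm>"
  unfolding proj_def by (intro subspace_sum[OF subspace_m] subspace_scale[OF subspace_m] e_in_m)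

lemma coord_proj: "i \<in> {1..8} \<Longrightarrow> coord i (proj x) = coord i x"
proof -
  assume i: "i \<in> {1..8}"
  have "coord i (proj x) = (\<Sum>j\<in>{1..8}. coord j x * coord i (e j))"
    by (simp add: proj_def coord_simps)
  also have "\<dots> = (\<Sum>j\<in>{1..8}. if i = j then coord j x else 0)"
    using i by (intro sum.cong) (simp_all add: coord_e)
  finally show ?thesis
    using i by simp
qed

lemma proj_id: "x \<in> \<mm> \<Longrightarrow> proj x = x"
proof -
  assume "x \<in> \<mm>"
  then have "x \<in> span (e ` {1..8})"
    by (simp add: \<mm>_def)
  then show ?thesis
  proof (rule linear_eq_on_span[OF linear_proj linear_ident, rotated])
    fix x assume "x \<in> e ` {1..8}"
    then obtain j where j: "j \<in> {1..8}" "x = e j"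
      by auto
    then have "proj x = (\<Sum>i\<in>{1..8}. if i = j then e i else 0)"
      unfolding proj_def by (intro sum.cong) (simp_all add: coord_e del: atLeastAtMost_iff)
    then show "proj x = x"
      using j by simp
  qed
qed

lemma coord_expansion: "x \<in> \<mm> \<Longrightarrow> x = (\<Sum>i\<in>{1..8}. coord i x *\<^sub>R e i)"
  using proj_id by (simp add: proj_def)

lemma eq_if_coord_eq:
  assumes "x \<in> \<mm>" "y \<in> \<mm>" "\<And>i. i \<in> {1..8} \<Longrightarrow> coord i x = coord i y"
  shows "x = y"
  using coord_expansion[OF assms(1)] coord_expansion[OF assms(2)] assms(3) by (metis (no_types, lifting) sum.cong)

lemma inner_proj:
  assumes "y \<in> \<mm>"
  shows "proj x \<bullet> y = x \<bullet> y"
proof -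
  have *: "proj x \<bullet> e i = x \<bullet> e i" if "i \<in> {1..8}" for i
    using coord_proj[OF that, of x] inner_e[OF that that] by (simp add: coord_def split: if_splits)
  have "proj x \<bullet> y = (\<Sum>i\<in>{1..8}. coord i y * (proj x \<bullet> e i))"
    by (subst coord_expansion[OF assms]) (simp add: inner_sum_right)
  also have "\<dots> = (\<Sum>i\<in>{1..8}. coord i y * (x \<bullet> e i))"
    by (intro sum.cong) (simp_all add: *)
  also have "\<dots> = x \<bullet> y"
    by (subst (2) coord_expansion[OF assms]) (simp add: inner_sum_right)
  finally show ?thesis .
qed

lemma inj_on_e: "inj_on e {1..8}"
proof (rule inj_onI)
  fix i j assume "i \<in> {1..8::nat}" "j \<in> {1..8::nat}" "e i = e j"
  then have "coord i (e i) = coord i (e j)"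
    by simp
  then show "i = j"
    using \<open>i \<in> {1..8}\<close> \<open>j \<in> {1..8}\<close> by (simp only: coord_e split: if_splits)
qed

lemma frame_e: "frame e"
proof -
  have "orthogonal (e i) (e j)" if "i \<in> {1..8}" "j \<in> {1..8}" "e i \<noteq> e j" for i j
    using inner_e[OF that(1,2)] that(3) by (cases "i = j") (simp_all add: orthogonal_def)
  then have "pairwise orthogonal (e ` {1..8})"
    unfolding pairwise_def by blast
  moreover have "e i \<noteq> 0" if "i \<in> {1..8}" for i
    using coord_e[OF that that] by (auto simp: coord_simps)
  then have "0 \<notin> e ` {1..8}"
    by (metis imageE)
  ultimately have "independent (e ` {1..8})"
    by (rule pairwise_orthogonal_independent)
  then show ?thesis
    using inj_on_e by (simp add: frame_def \<mm>_def)
qed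

lemma dual_e:
  assumes "i \<in> {1..8}" "x \<in> \<mm>"
  shows "dual e i x = coord i x"
proof -
  have ind: "independent (e ` {1..8})"
    using frame_e by (simp add: frame_def)
  have "dual e i x = (\<Sum>j\<in>{1..8}. representation (e ` {1..8}) (coord j x *\<^sub>R e j) (e i))"
    unfolding dual_def
    by (subst coord_expansion[OF assms(2)], subst representation_sum[OF ind])
       (intro span_scale span_base imageI, assumption, rule refl)
  also have "\<dots> = (\<Sum>j\<in>{1..8}. if j = i then coord j x else 0)"
  proof (rule sum.cong)
    fix j :: nat assume j: "j \<in> {1..8}"
    have "representation (e ` {1..8}) (coord j x *\<^sub>R e j) (e i) = coord j x * (if e i = e j then 1 else 0)"
      using j ind by (simp add: representation_scale span_base representation_basis)
    then show "representation (e ` {1..8}) (coord j x *\<^sub>R e j) (e i) = (if j = i then coord j x else 0)"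
      using inj_on_eq_iff[OF inj_on_e assms(1) j] by simp
  qed simp
  finally show ?thesis
    using assms(1) by simp
qed

lemma e_in_lie_G:
  assumes "i \<in> {1..8}"
  shows "e i \<in> lie_G"
  using assms unfolding atLeastAtMost_1_8
  by (elim insertE emptyE; simp add: e_matrices lie_G_def su_def vec_eq_iff forall_3 forall_2 trace_def sum_3 sum_2)

lemma m_subset_lie_G: "\<mm> \<subseteq> lie_G"
  unfolding \<mm>_def using e_in_lie_G by (intro span_minimal subspace_lie_G) auto

lemmas m_in_lie_G = subsetD[OF m_subset_lie_G]

text \<open>Skew-Hermitian symmetry and vanishing trace express every coordinate by entries of the
  first columns. For the \<open>su(3)\<close> component this column is the image of the first basis
  vector, exactly the data that \<open>lie_H\<close> forgets.\<close>

lemma coord_lie_G: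
  assumes "x \<in> lie_G"
  shows "coord 1 x = Re (fst x $ 2 $ 1)" "coord 2 x = Im (fst x $ 2 $ 1)"
    "coord 3 x = - Re (fst x $ 3 $ 1)" "coord 4 x = Im (fst x $ 3 $ 1)"
    "coord 5 x = sqrt 3 / 2 * Im (fst x $ 1 $ 1)"
    "coord 6 x = - 2 * Im (snd x $ 2 $ 1)" "coord 7 x = 2 * Re (snd x $ 2 $ 1)"
    "coord 8 x = - 2 * Im (snd x $ 1 $ 1)"
proof -
  have sk: "cnj (fst x $ j $ i) = - (fst x $ i $ j)" "cnj (snd x $ l $ k) = - (snd x $ k $ l)" for i j k l
    using assms by (auto simp: lie_G_iff star_def prod_eq_iff vec_eq_iff)
  have tr: "Im (fst x $ 3 $ 3) = - Im (fst x $ 1 $ 1) - Im (fst x $ 2 $ 2)"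
      "Im (snd x $ 2 $ 2) = - Im (snd x $ 1 $ 1)"
    using assms by (auto simp: lie_G_iff trace_def sum_3 sum_2 complex_eq_iff)
  have s: "Re (fst x $ 1 $ 2) = - Re (fst x $ 2 $ 1)" "Im (fst x $ 1 $ 2) = Im (fst x $ 2 $ 1)"
      "Re (fst x $ 1 $ 3) = - Re (fst x $ 3 $ 1)" "Im (fst x $ 1 $ 3) = Im (fst x $ 3 $ 1)"
      "Re (snd x $ 1 $ 2) = - Re (snd x $ 2 $ 1)" "Im (snd x $ 1 $ 2) = Im (snd x $ 2 $ 1)"
    using sk(1)[of 1 2] sk(1)[of 1 3] sk(2)[of 1 2] by (simp_all add: complex_eq_iff)
  have ip: "x \<bullet> e 1 = Re (fst x $ 2 $ 1) - Re (fst x $ 1 $ 2)"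
    "x \<bullet> e 2 = Im (fst x $ 2 $ 1) + Im (fst x $ 1 $ 2)"
    "x \<bullet> e 3 = Re (fst x $ 1 $ 3) - Re (fst x $ 3 $ 1)"
    "x \<bullet> e 4 = Im (fst x $ 1 $ 3) + Im (fst x $ 3 $ 1)"
    "x \<bullet> e 5 = (2 * Im (fst x $ 1 $ 1) - Im (fst x $ 2 $ 2) - Im (fst x $ 3 $ 3)) / sqrt 3"
    "x \<bullet> e 6 = - (Im (snd x $ 1 $ 2) + Im (snd x $ 2 $ 1)) / 2"
    "x \<bullet> e 7 = (Re (snd x $ 2 $ 1) - Re (snd x $ 1 $ 2)) / 2"
    "x \<bullet> e 8 = (Im (snd x $ 2 $ 2) - Im (snd x $ 1 $ 1)) / 2"
    by (simp_all add: e_matrices inner_prod_def inner_vec_def sum_3 sum_2 inner_complex_def diff_divide_distrib add_divide_distrib)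
  show "coord 1 x = Re (fst x $ 2 $ 1)" "coord 2 x = Im (fst x $ 2 $ 1)"
    "coord 3 x = - Re (fst x $ 3 $ 1)" "coord 4 x = Im (fst x $ 3 $ 1)"
    "coord 6 x = - 2 * Im (snd x $ 2 $ 1)" "coord 7 x = 2 * Re (snd x $ 2 $ 1)"
    "coord 8 x = - 2 * Im (snd x $ 1 $ 1)"
    unfolding coord_def ip by (simp_all add: inner_e s tr)
  \<comment> \<open>The trace condition turns the combination 2a - b - c of the diagonal entries
    into 3a; the division by 2 is the squared norm of \<open>e 5\<close>.\<close>
  have "coord 5 x = (3 / sqrt 3) / 2 * Im (fst x $ 1 $ 1)"
    unfolding coord_def ip by (simp add: inner_e tr)
  then show "coord 5 x = sqrt 3 / 2 * Im (fst x $ 1 $ 1)"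
    by (simp add: real_div_sqrt)
qed

lemma
  fixes x :: "nat \<Rightarrow> real"
  defines "X \<equiv> \<Sum>i\<in>{1..8}. x i *\<^sub>R e i"
  shows fst_sum_e: "fst X = vector
      [vector [Complex 0 (2 / sqrt 3 * x 5), Complex (- x 1) (x 2), Complex (x 3) (x 4)],
       vector [Complex (x 1) (x 2), Complex 0 (- x 5 / sqrt 3), 0],
       vector [Complex (- x 3) (x 4), 0, Complex 0 (- x 5 / sqrt 3)]]"
    and snd_sum_e: "snd X = vector
      [vector [Complex 0 (- x 8 / 2), Complex (- x 7 / 2) (- x 6 / 2)],
       vector [Complex (x 7 / 2) (- x 6 / 2), Complex 0 (x 8 / 2)]]"
  by (simp_all add: X_def sum_1_8 e_matrices vec_eq_iff forall_3 forall_2 complex_eq_iff)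

text \<open>By \<open>coord_lie_G\<close> the coordinates recover the whole second component and the
  first column of the first one. So \<open>x\<close> and \<open>proj x\<close> agree there, and the
  difference kills the first basis vector.\<close>

lemma diff_proj_lie_H:
  assumes "x \<in> lie_G"
  shows "x - proj x \<in> lie_H"
proof -
  have G: "x - proj x \<in> lie_G"
    using assms m_subset_lie_G by (intro subspace_diff[OF subspace_lie_G]) auto
  have sk: "cnj (fst x $ j $ i) = - (fst x $ i $ j)" "cnj (snd x $ l $ k) = - (snd x $ k $ l)" for i j k l
    using assms by (auto simp: lie_G_iff star_def prod_eq_iff vec_eq_iff)
  have s: "Re (snd x $ 1 $ 2) = - Re (snd x $ 2 $ 1)" "Im (snd x $ 1 $ 2) = Im (snd x $ 2 $ 1)"
    "Re (snd x $ i $ i) = 0" "Re (fst x $ j $ j) = 0" for i j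
    using sk(1)[of j j] sk(2)[of i i] sk(2)[of 1 2] by (simp_all add: complex_eq_iff)
  have t: "Im (snd x $ 2 $ 2) = - Im (snd x $ 1 $ 1)"
    using assms by (simp add: lie_G_iff trace_def sum_2 complex_eq_iff)
  have "snd x $ i $ j = snd (proj x) $ i $ j" for i j
    using exhaust_2[of i] exhaust_2[of j] s t
    by (auto simp: proj_def snd_sum_e coord_lie_G[OF assms] complex_eq_iff)
  then have "snd x = snd (proj x)"
    by (simp add: vec_eq_iff)
  moreover have "fst x $ i $ 1 = fst (proj x) $ i $ 1" for i
    using exhaust_3[of i] s
    by (auto simp: proj_def fst_sum_e coord_lie_G[OF assms] complex_eq_iff)
  then have "(fst x - fst (proj x)) *v axis 1 1 = 0"
    by (simp add: vec_eq_iff matrix_vector_mult_def sum_3 axis_def)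
  ultimately show ?thesis
    using G by (simp add: lie_H_iff)
qed

lemma lie_H_Int_m: "lie_H \<inter> \<mm> = {0}"
proof -
  have "x = 0" if "x \<in> lie_H" "x \<in> \<mm>" for x
  proof (rule eq_if_coord_eq[OF that(2) subspace_0[OF subspace_m]])
    have 1: "x \<in> lie_G" "snd x = 0" "fst x *v axis 1 1 = 0"
      using that by (auto simp: lie_H_iff)
    then have "fst x $ 1 $ 1 = 0" "fst x $ 2 $ 1 = 0" "fst x $ 3 $ 1 = 0"
      by (auto simp: vec_eq_iff matrix_vector_mult_def sum_3 axis_def)
    then show "coord i x = coord i 0" if "i \<in> {1..8}" for i
      using that 1 coord_lie_G[OF 1(1)] unfolding atLeastAtMost_1_8 by (auto simp: coord_simps)
  qed
  then show ?thesis
    using subspace_0[OF subspace_m] subspace_0[OF subspace_lie_H] by auto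
qed

lemma m_part_eq_proj:
  assumes "x \<in> lie_G"
  shows "m_part x = proj x"
  unfolding m_part_def
proof (rule the_equality)
  show "proj x \<in> \<mm> \<and> x - proj x \<in> lie_H"
    using assms by (simp add: diff_proj_lie_H)
next
  fix y assume y: "y \<in> \<mm> \<and> x - y \<in> lie_H"
  then have "(x - y) - (x - proj x) \<in> lie_H \<inter> \<mm>"
    using subspace_diff[OF subspace_lie_H, of "x - y" "x - proj x"] diff_proj_lie_H[OF assms]
      subspace_diff[OF subspace_m, of "proj x" y] by simp
  then show "y = proj x"
    using lie_H_Int_m by auto
qed

text \<open>The projection of an element of \<open>lie_H\<close> lies in \<open>lie_H\<close> and in
  \<open>\<mm>\<close>, hence is zero. So \<open>\<mm>\<close> is the orthogonal complement of
  \<open>lie_H\<close> in \<open>lie_G\<close>.\<close>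

lemma lie_H_orthogonal_m:
  assumes "x \<in> lie_H" "y \<in> \<mm>"
  shows "x \<bullet> y = 0"
proof -
  have "proj x \<in> lie_H \<inter> \<mm>"
    using subspace_diff[OF subspace_lie_H assms(1) diff_proj_lie_H[of x]] assms(1) by (simp add: lie_H_iff)
  then have "proj x = 0"
    using lie_H_Int_m by auto
  then show ?thesis
    using inner_proj[OF assms(2), of x] by simp
qed

text \<open>An orthogonal action that preserves \<open>lie_H\<close> preserves its orthogonal
  complement: the component of \<open>ad h x\<close> off \<open>\<mm>\<close> lies in
  \<open>lie_H\<close> and is orthogonal to itself.\<close>

lemma ad_in_m:
  assumes "h \<in> H" "x \<in> \<mm>"
  shows "ad h x \<in> \<mm>"
proof -
  let ?z = "ad h x - proj (ad h x)"
  have hG: "h \<in> G"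
    using assms H_subset_G by auto
  have z: "?z \<in> lie_H"
    using assms hG m_subset_lie_G by (intro diff_proj_lie_H ad_lie_G) auto
  have "?z \<bullet> ?z = ad h x \<bullet> ?z - proj (ad h x) \<bullet> ?z"
    by (rule inner_diff_left)
  also have "\<dots> = x \<bullet> ad (star h) ?z - proj (ad h x) \<bullet> ?z"
    by (simp add: inner_ad)
  also have "\<dots> = 0"
    using lie_H_orthogonal_m[OF ad_lie_H[OF star_in_H[OF assms(1)] z] assms(2)] lie_H_orthogonal_m[OF z proj_in_m]
    by (simp add: inner_commute)
  finally show ?thesis
    using proj_in_m[of "ad h x"] by simp
qed

text \<open>An orthogonal projection commutes with an orthogonal map that preserves its range. The
  argument covers arbitrary matrix pairs, which is the generality in which \<open>generator\<close>
  uses it.\<close>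

lemma proj_ad:
  assumes "h \<in> H"
  shows "proj (ad h x) = ad h (proj x)"
proof -
  let ?z = "proj (ad h x) - ad h (proj x)"
  have z: "?z \<in> \<mm>"
    using ad_in_m[OF assms] by (intro subspace_diff[OF subspace_m]) auto
  have "?z \<bullet> ?z = proj (ad h x) \<bullet> ?z - ad h (proj x) \<bullet> ?z"
    by (rule inner_diff_left)
  also have "\<dots> = x \<bullet> ad (star h) ?z - proj x \<bullet> ad (star h) ?z"
    by (simp only: inner_proj[OF z] inner_ad)
  also have "\<dots> = 0"
    using inner_proj[OF ad_in_m[OF star_in_H[OF assms] z]] by simp
  finally show ?thesis
    by simp
qed

lemma reductive: reductive_decomposition
  unfolding reductive_decomposition_def
proof (intro conjI ballI)
  fix z assume "z \<in> lie_G"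
  then show "\<exists>x\<in>lie_H. \<exists>y\<in>\<mm>. z = x + y"
    using diff_proj_lie_H proj_in_m by (metis diff_add_cancel)
next
  fix h assume "h \<in> H"
  then show "Ad h ` \<mm> \<subseteq> \<mm>"
    using ad_in_m H_subset_G Ad_eq_ad by (metis image_subsetI subsetD)
qed (use m_subset_lie_G lie_H_Int_m in auto)

section \<open>The forms\<close>

lemma wedge_3:
  "wedge \<theta> [i, j, k] [x, y, z] =
     \<theta> i x * (\<theta> j y * \<theta> k z - \<theta> j z * \<theta> k y) - \<theta> i y * (\<theta> j x * \<theta> k z - \<theta> j z * \<theta> k x)
     + \<theta> i z * (\<theta> j x * \<theta> k y - \<theta> j y * \<theta> k x)"
proof -
  have l: "{..<length [i, j, k]} = {0, 1, 2}"
    by auto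
  have f: "finite {1, 2::nat}" "0 \<notin> {1, 2::nat}" "finite {2::nat}" "1 \<notin> {2::nat}"
    by auto
  show ?thesis
    unfolding wedge_def l sum_over_permutations_insert[OF f(1,2)] sum_over_permutations_insert[OF f(3,4)] permutes_sing
    by (simp add: sign_swap_id permutation_swap_id sign_compose transpose_def) (simp add: algebra_simps)
qed

text \<open>The shuffle formula for the product of two two-forms.\<close>

definition wedge_pair :: "(mat_pair \<Rightarrow> mat_pair \<Rightarrow> real) \<Rightarrow> (mat_pair \<Rightarrow> mat_pair \<Rightarrow> real) \<Rightarrow> form" where
  "wedge_pair \<alpha> \<beta> vs = (let x = vs ! 0; y = vs ! 1; z = vs ! 2; w = vs ! 3 in
     \<alpha> x y * \<beta> z w - \<alpha> x z * \<beta> y w + \<alpha> x w * \<beta> y z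
     + \<alpha> y z * \<beta> x w - \<alpha> y w * \<beta> x z + \<alpha> z w * \<beta> x y)"

definition minor :: "(nat \<Rightarrow> mat_pair \<Rightarrow> real) \<Rightarrow> nat \<Rightarrow> nat \<Rightarrow> mat_pair \<Rightarrow> mat_pair \<Rightarrow> real" where
  "minor \<theta> i j x y = \<theta> i x * \<theta> j y - \<theta> i y * \<theta> j x"

text \<open>Laplace expansion of the 4 by 4 determinant along its first two rows.\<close>

lemma wedge_4:
  "wedge \<theta> [i, j, k, l] [x, y, z, w] = wedge_pair (minor \<theta> i j) (minor \<theta> k l) [x, y, z, w]"
proof -
  have l: "{..<length [i, j, k, l]} = {0, 1, 2, 3}"
    by auto
  have f: "finite {1, 2, 3::nat}" "0 \<notin> {1, 2, 3::nat}" "finite {2, 3::nat}" "1 \<notin> {2, 3::nat}"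
    "finite {3::nat}" "2 \<notin> {3::nat}"
    by auto
  show ?thesis
    unfolding wedge_def l sum_over_permutations_insert[OF f(1,2)] sum_over_permutations_insert[OF f(3,4)]
      sum_over_permutations_insert[OF f(5,6)] permutes_sing
    by (simp add: sign_swap_id permutation_swap_id sign_compose permutation_compose transpose_def)
       (simp add: wedge_pair_def minor_def algebra_simps)
qed

lemma wedge_cong:
  assumes "length vs = length is" "\<And>i v. i \<in> set is \<Longrightarrow> v \<in> set vs \<Longrightarrow> \<theta> i v = \<theta>' i v"
  shows "wedge \<theta> is vs = wedge \<theta>' is vs"
  unfolding wedge_def
proof (intro sum.cong arg_cong2[of _ _ _ _ "(*)"] prod.cong refl)
  fix p k assume "p \<in> {p. p permutes {..<length is}}" "k \<in> {..<length is}"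
  then have "p k < length vs"
    using assms(1) permutes_in_image[of p "{..<length is}" k] by auto
  then show "\<theta> (is ! k) (vs ! p k) = \<theta>' (is ! k) (vs ! p k)"
    using \<open>k \<in> _\<close> by (intro assms(2)) auto
qed

lemma length_eq_2: "length vs = 2 \<longleftrightarrow> (\<exists>x y. vs = [x, y])"
  by (auto simp: numeral_2_eq_2 length_Suc_conv)

lemma length_eq_3: "length vs = 3 \<longleftrightarrow> (\<exists>x y z. vs = [x, y, z])"
  by (auto simp: numeral_3_eq_3 length_Suc_conv)

lemma length_eq_4: "length vs = 4 \<longleftrightarrow> (\<exists>x y z w. vs = [x, y, z, w])"
proof -
  have "4 = Suc (Suc (Suc (Suc 0)))"
    by simp
  then show ?thesis
    by (simp only: length_Suc_conv length_0_conv) blast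
qed

lemma \<Phi>_coord:
  assumes "length vs = 4" "set vs \<subseteq> \<mm>"
  shows "\<Phi> vs = spin7_normal_form coord vs"
proof -
  have "wedge (dual e) is vs = wedge coord is vs" if "length is = 4" "set is \<subseteq> {1..8}" for "is"
    using assms that by (intro wedge_cong) (auto intro!: dual_e simp del: atLeastAtMost_iff)
  then show ?thesis
    by (simp add: \<Phi>_def spin7_normal_form_def)
qed

lemma torsion_3form_coord:
  assumes "length vs = 3" "set vs \<subseteq> \<mm>"
  shows "torsion_3form vs =
    - sqrt 3 * (wedge coord [1, 2, 5] vs - wedge coord [3, 4, 5] vs) + wedge coord [6, 7, 8] vs"
proof -
  have "wedge (dual e) is vs = wedge coord is vs" if "length is = 3" "set is \<subseteq> {1..8}" for "is"
    using assms that by (intro wedge_cong) (auto intro!: dual_e simp del: atLeastAtMost_iff)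
  then show ?thesis
    by (simp add: torsion_3form_def)
qed

lemma std_metric_coord:
  assumes "x \<in> \<mm>" "y \<in> \<mm>"
  shows "std_metric [x, y] = (\<Sum>i\<in>{1..8}. coord i x * coord i y)"
  using assms by (simp add: std_metric_def dual_e del: atLeastAtMost_iff)

lemma std_metric_e:
  assumes "x \<in> \<mm>" "k \<in> {1..8}"
  shows "std_metric [x, e k] = coord k x" "std_metric [e k, x] = coord k x"
proof -
  have "(\<Sum>i\<in>{1..8}. coord i x * coord i (e k)) = (\<Sum>i\<in>{1..8}. if i = k then coord i x else 0)"
    using assms by (intro sum.cong) (simp_all add: coord_e del: atLeastAtMost_iff)
  then show "std_metric [x, e k] = coord k x" "std_metric [e k, x] = coord k x"
    using assms by (simp_all add: std_metric_coord mult.commute)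
qed

section \<open>Invariance of the four-form and of the metric under \<open>H\<close>\<close>

definition \<omega>\<^sub>1 :: "mat_pair \<Rightarrow> mat_pair \<Rightarrow> real" where
  "\<omega>\<^sub>1 x y = minor coord 1 2 x y - minor coord 3 4 x y"

definition \<omega>\<^sub>2 :: "mat_pair \<Rightarrow> mat_pair \<Rightarrow> real" where
  "\<omega>\<^sub>2 x y = minor coord 1 3 x y + minor coord 2 4 x y"

definition \<omega>\<^sub>3 :: "mat_pair \<Rightarrow> mat_pair \<Rightarrow> real" where
  "\<omega>\<^sub>3 x y = minor coord 1 4 x y - minor coord 2 3 x y"

lemma wedge_pair_minor_self: "wedge_pair (minor \<theta> i j) (minor \<theta> i j) vs = 0"
  by (simp add: wedge_pair_def minor_def Let_def algebra_simps)

text \<open>Each two-form on the right is invariant by itself, whereas most single terms of the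
  normal form are not. In the square of \<open>\<omega>\<^sub>1\<close> the squares of the
  decomposable forms vanish and the cross term is counted twice, which gives the factor 1/2.\<close>

lemma spin7_normal_form_decomposition:
  assumes "length vs = 4"
  shows "spin7_normal_form coord vs = - wedge_pair \<omega>\<^sub>1 \<omega>\<^sub>1 vs / 2
    + wedge_pair \<omega>\<^sub>1 (minor coord 5 6) vs - wedge_pair \<omega>\<^sub>1 (minor coord 7 8) vs
    + wedge_pair \<omega>\<^sub>2 (minor coord 5 7) vs + wedge_pair \<omega>\<^sub>2 (minor coord 6 8) vs
    + wedge_pair \<omega>\<^sub>3 (minor coord 5 8) vs - wedge_pair \<omega>\<^sub>3 (minor coord 6 7) vs
    + wedge_pair (minor coord 5 6) (minor coord 7 8) vs"
proof -
  obtain x y z w where vs: "vs = [x, y, z, w]"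
    using assms by (auto simp: length_eq_4)
  have "wedge_pair \<omega>\<^sub>1 \<omega>\<^sub>1 vs = wedge_pair (minor coord 1 2) (minor coord 1 2) vs
      + wedge_pair (minor coord 3 4) (minor coord 3 4) vs - 2 * wedge_pair (minor coord 1 2) (minor coord 3 4) vs"
    by (simp add: wedge_pair_def \<omega>\<^sub>1_def Let_def algebra_simps)
  then have "wedge_pair \<omega>\<^sub>1 \<omega>\<^sub>1 vs = - 2 * wedge_pair (minor coord 1 2) (minor coord 3 4) vs"
    by (simp add: wedge_pair_minor_self)
  moreover have "wedge_pair \<omega>\<^sub>1 \<beta> vs = wedge_pair (minor coord 1 2) \<beta> vs - wedge_pair (minor coord 3 4) \<beta> vs"
    "wedge_pair \<omega>\<^sub>2 \<beta> vs = wedge_pair (minor coord 1 3) \<beta> vs + wedge_pair (minor coord 2 4) \<beta> vs"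
    "wedge_pair \<omega>\<^sub>3 \<beta> vs = wedge_pair (minor coord 1 4) \<beta> vs - wedge_pair (minor coord 2 3) \<beta> vs" for \<beta>
    by (simp_all add: wedge_pair_def \<omega>\<^sub>1_def \<omega>\<^sub>2_def \<omega>\<^sub>3_def Let_def algebra_simps)
  ultimately show ?thesis
    by (simp add: spin7_normal_form_def vs wedge_4)
qed

definition herm :: "mat_pair \<Rightarrow> mat_pair \<Rightarrow> complex" where
  "herm x y = cnj (fst x $ 2 $ 1) * fst y $ 2 $ 1 + cnj (fst x $ 3 $ 1) * fst y $ 3 $ 1"

definition area :: "mat_pair \<Rightarrow> mat_pair \<Rightarrow> complex" where
  "area x y = fst x $ 2 $ 1 * fst y $ 3 $ 1 - fst x $ 3 $ 1 * fst y $ 2 $ 1"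

text \<open>In the complex coordinates c1 + i c2 and - c3 + i c4 of the first column, these are the
  standard Hermitian and complex area forms of the complex plane. The minus sign at c3 comes from
  the orientation of \<open>e 3\<close> and accounts for the relative sign in
  \<open>\<omega>\<^sub>1\<close>.\<close>

lemma \<omega>_intrinsic:
  assumes "x \<in> lie_G" "y \<in> lie_G"
  shows "\<omega>\<^sub>1 x y = Im (herm x y)" "\<omega>\<^sub>2 x y = - Re (area x y)" "\<omega>\<^sub>3 x y = Im (area x y)"
    "coord 1 x * coord 1 y + coord 2 x * coord 2 y + coord 3 x * coord 3 y + coord 4 x * coord 4 y = Re (herm x y)"
  by (simp_all add: \<omega>\<^sub>1_def \<omega>\<^sub>2_def \<omega>\<^sub>3_def minor_def herm_def area_def coord_lie_G[OF assms(1)] coord_lie_G[OF assms(2)] algebra_simps)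

text \<open>An element of \<open>H\<close> is a block matrix with corner 1 and a lower 2 by 2 block
  in SU(2). Unitarity of the block preserves the Hermitian form, and its determinant 1 preserves the
  area form.\<close>

lemma
  assumes h: "h \<in> H"
  shows herm_ad: "herm (ad h x) (ad h y) = herm x y"
    and area_ad: "area (ad h x) (ad h y) = area x y"
    and corner_ad: "fst (ad h x) $ 1 $ 1 = fst x $ 1 $ 1"
    and snd_ad: "snd (ad h x) = snd x"
proof -
  obtain A where A: "h = (A, mat 1)" "A \<in> SU" "A *v axis 1 1 = axis 1 1"
    using h by (auto simp: H_def)
  obtain B where B: "star h = (B, mat 1)" "B *v axis 1 1 = axis 1 1"
    using star_in_H[OF h] by (auto simp: H_def)
  have A1: "A $ 1 $ 1 = 1" "A $ 2 $ 1 = 0" "A $ 3 $ 1 = 0"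
    using A(3) by (auto simp: vec_eq_iff matrix_vector_mult_def sum_3 axis_def)
  have B1: "B $ 1 $ 1 = 1" "B $ 2 $ 1 = 0" "B $ 3 $ 1 = 0"
    using B(2) by (auto simp: vec_eq_iff matrix_vector_mult_def sum_3 axis_def)
  \<comment> \<open>The inverse also fixes the first basis vector, so the first row of
    \<open>A\<close> is trivial as well as its first column.\<close>
  have "B = conj_transpose A"
    using A(1) B(1) by (simp add: star_def)
  then have A2: "A $ 1 $ 2 = 0" "A $ 1 $ 3 = 0"
    using B1 by simp_all
  have "conj_transpose A ** A = mat 1" and det: "det A = 1"
    using A(2) by (auto simp: SU_def)
  then have U: "(conj_transpose A ** A) $ i $ j = mat 1 $ i $ j" for i j
    by simp
  have u: "cnj (A $ 2 $ 2) * A $ 2 $ 2 + cnj (A $ 3 $ 2) * A $ 3 $ 2 = 1"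
    "cnj (A $ 2 $ 3) * A $ 2 $ 3 + cnj (A $ 3 $ 3) * A $ 3 $ 3 = 1"
    "cnj (A $ 2 $ 2) * A $ 2 $ 3 + cnj (A $ 3 $ 2) * A $ 3 $ 3 = 0"
    "cnj (A $ 2 $ 3) * A $ 2 $ 2 + cnj (A $ 3 $ 3) * A $ 3 $ 2 = 0"
    using U[of 2 2] U[of 3 3] U[of 2 3] U[of 3 2] A2
    by (simp_all add: matrix_matrix_mult_def sum_3 mat_def)
  have d: "A $ 2 $ 2 * A $ 3 $ 3 - A $ 2 $ 3 * A $ 3 $ 2 = 1"
    using det A1 A2 by (simp add: det_3)
  \<comment> \<open>Right multiplication by the inverse leaves the first column alone, so only left
    multiplication by \<open>A\<close> acts on it.\<close>
  have c: "fst (ad h x) $ i $ 1 = A $ i $ 1 * fst x $ 1 $ 1 + A $ i $ 2 * fst x $ 2 $ 1 + A $ i $ 3 * fst x $ 3 $ 1" for x i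
    using B1 by (simp add: ad_def gmul_def A(1)[symmetric] B(1)) (simp add: A(1) matrix_matrix_mult_def sum_3)
  show "fst (ad h x) $ 1 $ 1 = fst x $ 1 $ 1"
    by (simp add: c A1 A2)
  show "snd (ad h x) = snd x"
    by (simp add: ad_def gmul_def B(1)) (simp add: A(1))
  have "herm (ad h x) (ad h y) =
      (cnj (A $ 2 $ 2) * A $ 2 $ 2 + cnj (A $ 3 $ 2) * A $ 3 $ 2) * (cnj (fst x $ 2 $ 1) * fst y $ 2 $ 1)
    + (cnj (A $ 2 $ 3) * A $ 2 $ 3 + cnj (A $ 3 $ 3) * A $ 3 $ 3) * (cnj (fst x $ 3 $ 1) * fst y $ 3 $ 1)
    + (cnj (A $ 2 $ 2) * A $ 2 $ 3 + cnj (A $ 3 $ 2) * A $ 3 $ 3) * (cnj (fst x $ 2 $ 1) * fst y $ 3 $ 1)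
    + (cnj (A $ 2 $ 3) * A $ 2 $ 2 + cnj (A $ 3 $ 3) * A $ 3 $ 2) * (cnj (fst x $ 3 $ 1) * fst y $ 2 $ 1)"
    by (simp add: herm_def c A1 algebra_simps)
  then show "herm (ad h x) (ad h y) = herm x y"
    by (simp add: u herm_def)
  have "area (ad h x) (ad h y) = (A $ 2 $ 2 * A $ 3 $ 3 - A $ 2 $ 3 * A $ 3 $ 2) * area x y"
    by (simp add: area_def c A1 algebra_simps)
  then show "area (ad h x) (ad h y) = area x y"
    by (simp add: d)
qed

lemma coord_ad:
  assumes "h \<in> H" "x \<in> lie_G" "i \<in> {5..8}"
  shows "coord i (ad h x) = coord i x"
proof -
  have "ad h x \<in> lie_G"
    using assms H_subset_G by (intro ad_lie_G) auto
  moreover have "i \<in> {5, 6, 7, 8}"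
    using assms(3) by auto
  ultimately show ?thesis
    by (auto simp: coord_lie_G assms(2) corner_ad[OF assms(1)] snd_ad[OF assms(1)])
qed

lemma Ad_H_invariant_\<Phi>: "Ad_H_invariant 4 \<Phi>"
  unfolding Ad_H_invariant_def
proof (intro ballI allI impI, elim conjE)
  fix h vs assume h: "h \<in> H" and vs: "length vs = 4" "set vs \<subseteq> \<mm>"
  then obtain x y z w where xs: "vs = [x, y, z, w]"
    by (auto simp: length_eq_4)
  have hG: "h \<in> G"
    using h H_subset_G by auto
  have \<omega>: "\<omega>\<^sub>1 (ad h u) (ad h v) = \<omega>\<^sub>1 u v" "\<omega>\<^sub>2 (ad h u) (ad h v) = \<omega>\<^sub>2 u v" "\<omega>\<^sub>3 (ad h u) (ad h v) = \<omega>\<^sub>3 u v"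
    if "u \<in> \<mm>" "v \<in> \<mm>" for u v
    using that by (simp_all add: \<omega>_intrinsic m_in_lie_G ad_lie_G[OF hG] herm_ad[OF h] area_ad[OF h])
  have m: "minor coord i j (ad h u) (ad h v) = minor coord i j u v" if "u \<in> \<mm>" "v \<in> \<mm>" "i \<in> {5..8}" "j \<in> {5..8}" for i j u v
    using that by (simp add: minor_def coord_ad[OF h] m_in_lie_G)
  have "spin7_normal_form coord (map (ad h) vs) = spin7_normal_form coord vs"
    using vs xs by (simp add: spin7_normal_form_decomposition wedge_pair_def \<omega> m Let_def)
  then show "\<Phi> (map (Ad h) vs) = \<Phi> vs"
    using vs ad_in_m[OF h] by (subst (1 2) \<Phi>_coord) (auto simp: Ad_eq_ad[OF hG])
qed

lemma Ad_H_invariant_std_metric: "Ad_H_invariant 2 std_metric"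
  unfolding Ad_H_invariant_def
proof (intro ballI allI impI, elim conjE)
  fix h vs assume h: "h \<in> H" and vs: "length vs = 2" "set vs \<subseteq> \<mm>"
  then obtain x y where xs: "vs = [x, y]" "x \<in> \<mm>" "y \<in> \<mm>"
    by (auto simp: length_eq_2)
  have hG: "h \<in> G"
    using h H_subset_G by auto
  have l: "x \<in> lie_G" "y \<in> lie_G" "ad h x \<in> lie_G" "ad h y \<in> lie_G"
    using xs by (simp_all add: m_in_lie_G ad_lie_G[OF hG])
  have "(\<Sum>i\<in>{1..8}. coord i (ad h x) * coord i (ad h y)) = (\<Sum>i\<in>{1..8}. coord i x * coord i y)"
    unfolding sum_1_8 \<omega>_intrinsic(4)[OF l(3,4)] \<omega>_intrinsic(4)[OF l(1,2)]
    by (simp add: herm_ad[OF h] coord_ad[OF h] l)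
  then show "std_metric (map (Ad h) vs) = std_metric vs"
    using xs ad_in_m[OF h] by (simp add: Ad_eq_ad[OF hG] std_metric_coord)
qed

section \<open>Structure constants and natural reductivity\<close>

lemma coord_bracket:
  assumes "x \<in> \<mm>" "y \<in> \<mm>"
  shows "coord 1 (bracket x y) = - sqrt 3 * minor coord 2 5 x y"
    "coord 2 (bracket x y) = sqrt 3 * minor coord 1 5 x y"
    "coord 3 (bracket x y) = sqrt 3 * minor coord 4 5 x y"
    "coord 4 (bracket x y) = - sqrt 3 * minor coord 3 5 x y"
    "coord 5 (bracket x y) = sqrt 3 * (minor coord 3 4 x y - minor coord 1 2 x y)"
    "coord 6 (bracket x y) = minor coord 7 8 x y"
    "coord 7 (bracket x y) = - minor coord 6 8 x y"
    "coord 8 (bracket x y) = minor coord 6 7 x y"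
proof -
  have G: "bracket x y \<in> lie_G"
    using assms m_subset_lie_G by (intro bracket_lie_G) auto
  have f: "fst x = vector
      [vector [Complex 0 (2 / sqrt 3 * coord 5 x), Complex (- coord 1 x) (coord 2 x), Complex (coord 3 x) (coord 4 x)],
       vector [Complex (coord 1 x) (coord 2 x), Complex 0 (- coord 5 x / sqrt 3), 0],
       vector [Complex (- coord 3 x) (coord 4 x), 0, Complex 0 (- coord 5 x / sqrt 3)]]"
    "snd x = vector
      [vector [Complex 0 (- coord 8 x / 2), Complex (- coord 7 x / 2) (- coord 6 x / 2)],
       vector [Complex (coord 7 x / 2) (- coord 6 x / 2), Complex 0 (coord 8 x / 2)]]" if "x \<in> \<mm>" for x
    using fst_sum_e[of "\<lambda>i. coord i x"] snd_sum_e[of "\<lambda>i. coord i x"] coord_expansion[OF that] by simp_all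
  \<comment> \<open>Moving the root to the numerator lets the simplifier combine terms that reach
    the same radical in different ways.\<close>
  have s: "a / sqrt 3 = sqrt 3 * a / 3" for a
    by (simp add: field_simps)
  show "coord 1 (bracket x y) = - sqrt 3 * minor coord 2 5 x y"
    "coord 2 (bracket x y) = sqrt 3 * minor coord 1 5 x y"
    "coord 3 (bracket x y) = sqrt 3 * minor coord 4 5 x y"
    "coord 4 (bracket x y) = - sqrt 3 * minor coord 3 5 x y"
    "coord 5 (bracket x y) = sqrt 3 * (minor coord 3 4 x y - minor coord 1 2 x y)"
    "coord 6 (bracket x y) = minor coord 7 8 x y"
    "coord 7 (bracket x y) = - minor coord 6 8 x y"
    "coord 8 (bracket x y) = minor coord 6 7 x y"
    unfolding coord_lie_G[OF G]
    by (simp_all add: bracket_def gmul_def matrix_matrix_mult_def sum_3 sum_2 f[OF assms(1)] f[OF assms(2)] minor_def s algebra_simps)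
qed

text \<open>One computation serves two claims: skewness of the right-hand side is natural
  reductivity, and the left-hand side will be the torsion of the canonical connection.\<close>

lemma torsion_3form_bracket:
  assumes "x \<in> \<mm>" "y \<in> \<mm>" "z \<in> \<mm>"
  shows "std_metric [proj (bracket x y), z] = torsion_3form [x, y, z]"
  using assms
  by (simp add: std_metric_coord coord_proj torsion_3form_coord sum_1_8 coord_bracket wedge_3 minor_def algebra_simps)

lemma torsion_3form_skew:
  assumes "x \<in> \<mm>" "y \<in> \<mm>" "z \<in> \<mm>"
  shows "torsion_3form [x, y, z] = - torsion_3form [y, x, z]" "torsion_3form [x, y, z] = - torsion_3form [x, z, y]"
  using assms by (simp_all add: torsion_3form_coord wedge_3 algebra_simps)

lemma naturally_reductive_std_metric: "naturally_reductive std_metric"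
proof -
  have "std_metric [m_part (bracket x y), z] = torsion_3form [x, y, z]" if "x \<in> \<mm>" "y \<in> \<mm>" "z \<in> \<mm>" for x y z
    using that by (simp add: m_part_eq_proj bracket_lie_G m_in_lie_G torsion_3form_bracket)
  then show ?thesis
    unfolding naturally_reductive_def
    using reductive Ad_H_invariant_std_metric torsion_3form_skew by metis
qed

lemma invariant_spin7_structure_\<Phi>: "invariant_spin7_structure \<Phi>"
  unfolding invariant_spin7_structure_def using Ad_H_invariant_\<Phi> frame_e by (auto simp: \<Phi>_def)

lemma induced_metric_\<Phi>: "induced_metric \<Phi> std_metric"
  unfolding induced_metric_def using frame_e by (intro exI[of _ e]) (simp add: \<Phi>_def std_metric_def)

section \<open>Smooth functions on the group\<close>

lemma Ck_on_subset: "Ck_on k U f \<Longrightarrow> V \<subseteq> U \<Longrightarrow> Ck_on k V f"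
  by (induction k arbitrary: f) (auto intro: continuous_on_subset)

lemma Ck_on_cong:
  assumes "open U" "\<And>x. x \<in> U \<Longrightarrow> f x = g x" "Ck_on k U f"
  shows "Ck_on k U g"
  using assms
proof (induction k arbitrary: f g)
  case 0
  then show ?case
    using continuous_on_cong[of U U f g] by simp
next
  case (Suc k)
  have d: "f differentiable at x" if "x \<in> U" for x
    using Suc.prems(3) that by simp
  have "g differentiable at x" if "x \<in> U" for x
    using d[OF that] has_derivative_transform_within_open[where f = f and g = g, OF _ Suc.prems(1) that Suc.prems(2)]
    unfolding differentiable_def by blast
  moreover have "Ck_on k U (\<lambda>x. frechet_derivative g (at x) v)" for v
  proof (rule Suc.IH[OF Suc.prems(1)])
    show "frechet_derivative f (at x) v = frechet_derivative g (at x) v" if "x \<in> U" for x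
      using frechet_derivative_transform_within_open[OF d[OF that] Suc.prems(1) that Suc.prems(2)] by simp
    show "Ck_on k U (\<lambda>x. frechet_derivative f (at x) v)"
      using Suc.prems(3) by simp
  qed
  ultimately show ?case
    by simp
qed

text \<open>Allows an explicit derivative in place of \<open>frechet_derivative\<close>. The two
  agree only on \<open>U\<close>, and openness makes this enough for the higher derivatives, which
  see a neighbourhood of each point.\<close>

lemma Ck_on_SucI:
  assumes "open U" "\<And>x. x \<in> U \<Longrightarrow> (f has_derivative f' x) (at x)" "\<And>v. Ck_on k U (\<lambda>x. f' x v)"
  shows "Ck_on (Suc k) U f"
proof -
  have "Ck_on k U (\<lambda>x. frechet_derivative f (at x) v)" for v
    using assms(1) _ assms(3)[of v]
  proof (rule Ck_on_cong)
    show "f' x v = frechet_derivative f (at x) v" if "x \<in> U" for x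
      using frechet_derivative_at[OF assms(2)[OF that]] by simp
  qed
  moreover have "f differentiable at x" if "x \<in> U" for x
    using assms(2)[OF that] by (auto simp: differentiable_def)
  ultimately show ?thesis
    by simp
qed

lemma Ck_on_has_derivative:
  "Ck_on (Suc k) U f \<Longrightarrow> x \<in> U \<Longrightarrow> (f has_derivative frechet_derivative f (at x)) (at x)"
  using frechet_derivative_works by auto

lemma Ck_on_SucD: "Ck_on (Suc k) U f \<Longrightarrow> Ck_on k U f"
proof (induction k arbitrary: f)
  case 0
  then show ?case
    by (auto intro!: continuous_at_imp_continuous_on differentiable_imp_continuous_within)
next
  case (Suc k)
  then show ?case
    by (metis Ck_on.simps(2))
qed

lemma Ck_on_const: "Ck_on k U (\<lambda>x. c)"
proof (induction k arbitrary: c)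
  case (Suc k)
  have "frechet_derivative (\<lambda>x. c) (at x) = (\<lambda>v. 0)" for x :: 'a
    by (rule frechet_derivative_const)
  then show ?case
    using Suc by simp
qed simp

lemma Ck_on_add:
  assumes "open U" "Ck_on k U f" "Ck_on k U g"
  shows "Ck_on k U (\<lambda>x. f x + g x)"
  using assms
proof (induction k arbitrary: f g)
  case 0
  then show ?case
    by (simp add: continuous_on_add)
next
  case (Suc k)
  show ?case
  proof (rule Ck_on_SucI[OF Suc.prems(1)])
    show "((\<lambda>x. f x + g x) has_derivative (\<lambda>v. frechet_derivative f (at x) v + frechet_derivative g (at x) v)) (at x)"
      if "x \<in> U" for x
      using that Suc.prems by (intro has_derivative_add Ck_on_has_derivative)
    show "Ck_on k U (\<lambda>x. frechet_derivative f (at x) v + frechet_derivative g (at x) v)" for v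
      using Suc by simp
  qed
qed

text \<open>The product rule yields two products of the same bilinear kind, so the induction must
  vary both factors. Applied to \<open>gmul\<close> and to scalar multiplication, this covers all
  products below.\<close>

lemma Ck_on_bilinear:
  fixes prd :: "'b::euclidean_space \<Rightarrow> 'c::euclidean_space \<Rightarrow> 'd::euclidean_space"
  assumes "bounded_bilinear prd" "open U" "Ck_on k U f" "Ck_on k U g"
  shows "Ck_on k U (\<lambda>x. prd (f x) (g x))"
  using assms(2-4)
proof (induction k arbitrary: f g)
  case 0
  then show ?case
    by (simp add: bounded_bilinear.continuous_on[OF assms(1)])
next
  case (Suc k)
  show ?case
  proof (rule Ck_on_SucI[OF Suc.prems(1)])
    show "((\<lambda>x. prd (f x) (g x)) has_derivative
        (\<lambda>v. prd (f x) (frechet_derivative g (at x) v) + prd (frechet_derivative f (at x) v) (g x))) (at x)"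
      if "x \<in> U" for x
      using that Suc.prems by (intro bounded_bilinear.FDERIV[OF assms(1)] Ck_on_has_derivative)
    show "Ck_on k U (\<lambda>x. prd (f x) (frechet_derivative g (at x) v) + prd (frechet_derivative f (at x) v) (g x))" for v
      using Suc Ck_on_SucD[OF Suc.prems(2)] Ck_on_SucD[OF Suc.prems(3)]
      by (intro Ck_on_add) simp_all
  qed
qed

lemma Ck_on_linear:
  fixes L :: "'b::euclidean_space \<Rightarrow> 'c::euclidean_space"
  assumes "bounded_linear L" "open U" "Ck_on k U g"
  shows "Ck_on k U (\<lambda>x. L (g x))"
  using assms(2,3)
proof (induction k arbitrary: g)
  case 0
  then show ?case
    by (simp add: bounded_linear.continuous_on[OF assms(1)])
next
  case (Suc k)
  show ?case
  proof (rule Ck_on_SucI[OF Suc.prems(1)])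
    show "((\<lambda>x. L (g x)) has_derivative (\<lambda>v. L (frechet_derivative g (at x) v))) (at x)"
      if "x \<in> U" for x
      using that Suc.prems by (intro bounded_linear.has_derivative[OF assms(1)] Ck_on_has_derivative)
    show "Ck_on k U (\<lambda>x. L (frechet_derivative g (at x) v))" for v
      using Suc by simp
  qed
qed

lemma Ck_on_ident: "open U \<Longrightarrow> Ck_on k U (\<lambda>x. x)"
proof (cases k)
  case (Suc l)
  assume "open U"
  then show ?thesis
    unfolding Suc by (intro Ck_on_SucI[of U "\<lambda>x. x" "\<lambda>x v. v"] Ck_on_const has_derivative_ident)
qed simp

lemma smooth_G_cong:
  assumes "\<And>a. a \<in> G \<Longrightarrow> f a = g a" "smooth_G f"
  shows "smooth_G g"
  using assms unfolding smooth_G_def by metis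

lemma smooth_G_const: "smooth_G (\<lambda>a. c)"
  unfolding smooth_G_def by (intro exI[of _ UNIV] exI[of _ "\<lambda>a. c"]) (simp add: Ck_on_const)

lemma smooth_G_ident: "smooth_G (\<lambda>a. a)"
  unfolding smooth_G_def by (intro exI[of _ UNIV] exI[of _ "\<lambda>a. a"]) (simp add: Ck_on_ident)

lemma smooth_G_bilinear:
  assumes "bounded_bilinear prd" "smooth_G f" "smooth_G g"
  shows "smooth_G (\<lambda>a. prd (f a) (g a))"
proof -
  obtain U f' where U: "open U" "G \<subseteq> U" "\<And>k. Ck_on k U f'" "\<And>a. a \<in> G \<Longrightarrow> f' a = f a"
    using assms(2) unfolding smooth_G_def by blast
  obtain V g' where V: "open V" "G \<subseteq> V" "\<And>k. Ck_on k V g'" "\<And>a. a \<in> G \<Longrightarrow> g' a = g a"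
    using assms(3) unfolding smooth_G_def by blast
  have "Ck_on k (U \<inter> V) f'" "Ck_on k (U \<inter> V) g'" for k
    using U(3) V(3) by (auto intro: Ck_on_subset)
  then show ?thesis
    unfolding smooth_G_def using U V
    by (intro exI[of _ "U \<inter> V"] exI[of _ "\<lambda>a. prd (f' a) (g' a)"])
       (auto intro: Ck_on_bilinear[OF assms(1)])
qed

lemma smooth_G_add:
  assumes "smooth_G f" "smooth_G g"
  shows "smooth_G (\<lambda>a. f a + g a)"
proof -
  obtain U f' where U: "open U" "G \<subseteq> U" "\<And>k. Ck_on k U f'" "\<And>a. a \<in> G \<Longrightarrow> f' a = f a"
    using assms(1) unfolding smooth_G_def by blast
  obtain V g' where V: "open V" "G \<subseteq> V" "\<And>k. Ck_on k V g'" "\<And>a. a \<in> G \<Longrightarrow> g' a = g a"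
    using assms(2) unfolding smooth_G_def by blast
  have "Ck_on k (U \<inter> V) f'" "Ck_on k (U \<inter> V) g'" for k
    using U(3) V(3) by (auto intro: Ck_on_subset)
  then show ?thesis
    unfolding smooth_G_def using U V
    by (intro exI[of _ "U \<inter> V"] exI[of _ "\<lambda>a. f' a + g' a"]) (auto intro: Ck_on_add)
qed

lemma smooth_G_linear:
  assumes "bounded_linear L" "smooth_G f"
  shows "smooth_G (\<lambda>a. L (f a))"
proof -
  obtain U f' where U: "open U" "G \<subseteq> U" "\<And>k. Ck_on k U f'" "\<And>a. a \<in> G \<Longrightarrow> f' a = f a"
    using assms(2) unfolding smooth_G_def by blast
  then show ?thesis
    unfolding smooth_G_def
    by (intro exI[of _ U] exI[of _ "\<lambda>a. L (f' a)"]) (auto intro: Ck_on_linear[OF assms(1)])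
qed

lemma smooth_G_sum:
  assumes "\<And>i. i \<in> I \<Longrightarrow> smooth_G (f i)"
  shows "smooth_G (\<lambda>a. \<Sum>i\<in>I. f i a)"
  using assms by (induction I rule: infinite_finite_induct) (auto intro: smooth_G_const smooth_G_add)

lemma smooth_G_has_derivative:
  assumes "smooth_G f" "a \<in> G"
  shows "(f has_derivative frechet_derivative f (at a within G)) (at a within G)"
proof -
  obtain U f' where U: "open U" "G \<subseteq> U" "\<And>k. Ck_on k U f'" "\<And>a. a \<in> G \<Longrightarrow> f' a = f a"
    using assms(1) unfolding smooth_G_def by blast
  have "(f' has_derivative frechet_derivative f' (at a)) (at a within G)"
    using U(2) assms(2) by (blast intro: has_derivative_at_withinI[OF Ck_on_has_derivative[OF U(3)]])
  then have "(f has_derivative frechet_derivative f' (at a)) (at a within G)"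
    using U(4) by (intro has_derivative_transform[OF assms(2), of f f']) simp_all
  then show ?thesis
    using differentiableI frechet_derivative_works by blast
qed

section \<open>Derivatives along the group\<close>

lemma SU_2:
  assumes "p * cnj p + q * cnj q = 1"
  shows "(vector [vector [p, - cnj q], vector [q, cnj p]] :: complex^2^2) \<in> SU"
  using assms
  by (simp add: SU_def vec_eq_iff forall_2 matrix_matrix_mult_def sum_2 mat_def det_2 algebra_simps)

lemma SU_3:
  assumes "p * cnj p + q * cnj q = 1"
  shows "(vector [vector [p, - cnj q, 0], vector [q, cnj p, 0], vector [0, 0, 1]] :: complex^3^3) \<in> SU"
    and "(vector [vector [p, 0, - cnj q], vector [0, 1, 0], vector [q, 0, cnj p]] :: complex^3^3) \<in> SU"
  using assms
  by (simp_all add: SU_def vec_eq_iff forall_3 matrix_matrix_mult_def sum_3 mat_def det_3 algebra_simps)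

lemma SU_3_diag:
  assumes "p * cnj p = 1"
  shows "(vector [vector [p * p, 0, 0], vector [0, cnj p, 0], vector [0, 0, cnj p]] :: complex^3^3) \<in> SU"
proof -
  have "p * (p * (cnj p * cnj p)) = (p * cnj p) * (p * cnj p)" "p * p * cnj p * cnj p = (p * cnj p) * (p * cnj p)"
    "cnj p * p = p * cnj p"
    by (simp_all add: algebra_simps)
  then show ?thesis
    using assms
    by (simp add: SU_def vec_eq_iff forall_3 matrix_matrix_mult_def sum_3 mat_def det_3 ac_simps)
qed

text \<open>Two frequencies are provided for the curve with velocity \<open>e 5\<close>, whose
  diagonal entries rotate at different speeds; the other curves take the second frequency to be
  zero.\<close>

lemma has_vector_derivative_trig:
  fixes m a b a' b' :: "'a::real_normed_vector"
  assumes "\<And>t. \<gamma> t = m + cos (r * t) *\<^sub>R a + sin (r * t) *\<^sub>R b + cos (s * t) *\<^sub>R a' + sin (s * t) *\<^sub>R b'"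
  shows "(\<gamma> has_vector_derivative (r *\<^sub>R b + s *\<^sub>R b')) (at 0)"
proof -
  have "((\<lambda>t. m + cos (r * t) *\<^sub>R a + sin (r * t) *\<^sub>R b + cos (s * t) *\<^sub>R a' + sin (s * t) *\<^sub>R b')
      has_vector_derivative (r *\<^sub>R b + s *\<^sub>R b')) (at 0)"
    by (auto intro!: derivative_eq_intros)
  then show ?thesis
    using assms by presburger
qed

text \<open>The curves are the one-parameter subgroups generated by the \<open>e i\<close>, in
  closed form. The half angles in the SU(2) factor come from the factor 1/2 in \<open>e 6\<close>,
  \<open>e 7\<close> and \<open>e 8\<close>.\<close>

lemma curve_e:
  assumes "i \<in> {1..8}"
  shows "\<exists>\<gamma>. \<gamma> 0 = gone \<and> (\<forall>t. \<gamma> t \<in> G) \<and> (\<gamma> has_vector_derivative e i) (at (0::real))"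
proof -
  have curve: ?thesis if "\<And>t. \<gamma> t \<in> G" "\<gamma> 0 = gone" "r *\<^sub>R b + s *\<^sub>R b' = e i"
    "\<And>t. \<gamma> t = m + cos (r * t) *\<^sub>R a + sin (r * t) *\<^sub>R b + cos (s * t) *\<^sub>R a' + sin (s * t) *\<^sub>R b'" for \<gamma> m r s a b a' b'
    using that has_vector_derivative_trig[of \<gamma> m r a b s a' b'] by metis
  have sq: "of_real (cos t) * of_real (cos t) + of_real (sin t) * of_real (sin t) = (1::complex)"
      "of_real (cos t) * of_real (cos t) - \<i> * of_real (sin t) * (\<i> * of_real (sin t)) = (1::complex)" for t :: real
    by (simp_all add: complex_eq_iff)
  note simps = e_matrices vec_eq_iff forall_3 forall_2 mat_def gone_def complex_eq_iff
  consider "i = 1" | "i = 2" | "i = 3" | "i = 4" | "i = 5" | "i = 6" | "i = 7" | "i = 8"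
    using assms by force
  then show ?thesis
  proof cases
    case 1
    have "((vector [vector [of_real (cos t), - of_real (sin t), 0], vector [of_real (sin t), of_real (cos t), 0], vector [0, 0, 1]], mat 1) :: mat_pair) \<in> SU \<times> SU" for t :: real
      using SU_3(1)[of "of_real (cos t)" "of_real (sin t)"] sq by simp
    then show ?thesis
      by (intro curve[of "\<lambda>t. (vector [vector [of_real (cos t), - of_real (sin t), 0], vector [of_real (sin t), of_real (cos t), 0], vector [0, 0, 1]], mat 1)"
            1 "(vector [vector [0, - 1, 0], vector [1, 0, 0], vector [0, 0, 0]], 0)" 0 0
            "(vector [vector [0, 0, 0], vector [0, 0, 0], vector [0, 0, 1]], mat 1)"
            "(vector [vector [1, 0, 0], vector [0, 1, 0], vector [0, 0, 0]], 0)" 0])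
         (simp add: G_def, simp_all add: 1 simps)
  next
    case 2
    have "((vector [vector [of_real (cos t), \<i> * of_real (sin t), 0], vector [\<i> * of_real (sin t), of_real (cos t), 0], vector [0, 0, 1]], mat 1) :: mat_pair) \<in> SU \<times> SU" for t :: real
      using SU_3(1)[of "of_real (cos t)" "\<i> * of_real (sin t)"] sq by simp
    then show ?thesis
      by (intro curve[of "\<lambda>t. (vector [vector [of_real (cos t), \<i> * of_real (sin t), 0], vector [\<i> * of_real (sin t), of_real (cos t), 0], vector [0, 0, 1]], mat 1)"
            1 "(vector [vector [0, \<i>, 0], vector [\<i>, 0, 0], vector [0, 0, 0]], 0)" 0 0
            "(vector [vector [0, 0, 0], vector [0, 0, 0], vector [0, 0, 1]], mat 1)"
            "(vector [vector [1, 0, 0], vector [0, 1, 0], vector [0, 0, 0]], 0)" 0])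
         (simp add: G_def, simp_all add: 2 simps)
  next
    case 3
    have "((vector [vector [of_real (cos t), 0, of_real (sin t)], vector [0, 1, 0], vector [- of_real (sin t), 0, of_real (cos t)]], mat 1) :: mat_pair) \<in> SU \<times> SU" for t :: real
      using SU_3(2)[of "of_real (cos t)" "- of_real (sin t)"] sq by simp
    then show ?thesis
      by (intro curve[of "\<lambda>t. (vector [vector [of_real (cos t), 0, of_real (sin t)], vector [0, 1, 0], vector [- of_real (sin t), 0, of_real (cos t)]], mat 1)"
            1 "(vector [vector [0, 0, 1], vector [0, 0, 0], vector [- 1, 0, 0]], 0)" 0 0
            "(vector [vector [0, 0, 0], vector [0, 1, 0], vector [0, 0, 0]], mat 1)"
            "(vector [vector [1, 0, 0], vector [0, 0, 0], vector [0, 0, 1]], 0)" 0])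
         (simp add: G_def, simp_all add: 3 simps)
  next
    case 4
    have "((vector [vector [of_real (cos t), 0, \<i> * of_real (sin t)], vector [0, 1, 0], vector [\<i> * of_real (sin t), 0, of_real (cos t)]], mat 1) :: mat_pair) \<in> SU \<times> SU" for t :: real
      using SU_3(2)[of "of_real (cos t)" "\<i> * of_real (sin t)"] sq by simp
    then show ?thesis
      by (intro curve[of "\<lambda>t. (vector [vector [of_real (cos t), 0, \<i> * of_real (sin t)], vector [0, 1, 0], vector [\<i> * of_real (sin t), 0, of_real (cos t)]], mat 1)"
            1 "(vector [vector [0, 0, \<i>], vector [0, 0, 0], vector [\<i>, 0, 0]], 0)" 0 0
            "(vector [vector [0, 0, 0], vector [0, 1, 0], vector [0, 0, 0]], mat 1)"
            "(vector [vector [1, 0, 0], vector [0, 0, 0], vector [0, 0, 1]], 0)" 0])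
         (simp add: G_def, simp_all add: 4 simps)
  next
    case 5
    have "(vector [vector [cis (2 / sqrt 3 * t), 0, 0], vector [0, cis (- (t / sqrt 3)), 0],
        vector [0, 0, cis (- (t / sqrt 3))]] :: complex^3^3) \<in> SU" for t
      using SU_3_diag[of "cis (t / sqrt 3)"] by (simp add: cis_mult cis_cnj)
    then show ?thesis
      by (intro curve[of "\<lambda>t. (vector [vector [cis (2 / sqrt 3 * t), 0, 0], vector [0, cis (- (t / sqrt 3)), 0],
            vector [0, 0, cis (- (t / sqrt 3))]], mat 1)"
            "2 / sqrt 3" "(vector [vector [\<i>, 0, 0], vector [0, 0, 0], vector [0, 0, 0]], 0)"
            "1 / sqrt 3" "(vector [vector [0, 0, 0], vector [0, - \<i>, 0], vector [0, 0, - \<i>]], 0)"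
            "(0, mat 1)" "(vector [vector [1, 0, 0], vector [0, 0, 0], vector [0, 0, 0]], 0)"
            "(vector [vector [0, 0, 0], vector [0, 1, 0], vector [0, 0, 1]], 0)"])
         (simp add: G_def, simp_all add: 5 simps)
  next
    case 6
    have "((mat 1, vector [vector [of_real (cos (1 / 2 * t)), - \<i> * of_real (sin (1 / 2 * t))], vector [- \<i> * of_real (sin (1 / 2 * t)), of_real (cos (1 / 2 * t))]]) :: mat_pair) \<in> SU \<times> SU" for t :: real
      using SU_2[of "of_real (cos (1 / 2 * t))" "- \<i> * of_real (sin (1 / 2 * t))"] sq by simp
    then show ?thesis
      by (intro curve[of "\<lambda>t. (mat 1, vector [vector [of_real (cos (1 / 2 * t)), - \<i> * of_real (sin (1 / 2 * t))], vector [- \<i> * of_real (sin (1 / 2 * t)), of_real (cos (1 / 2 * t))]])"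
            "1 / 2" "(0, vector [vector [0, - \<i>], vector [- \<i>, 0]])" 0 0 "(mat 1, 0)" "(0, mat 1)" 0])
         (simp add: G_def, simp_all add: 6 simps)
  next
    case 7
    have "((mat 1, vector [vector [of_real (cos (1 / 2 * t)), - of_real (sin (1 / 2 * t))], vector [of_real (sin (1 / 2 * t)), of_real (cos (1 / 2 * t))]]) :: mat_pair) \<in> SU \<times> SU" for t :: real
      using SU_2[of "of_real (cos (1 / 2 * t))" "of_real (sin (1 / 2 * t))"] sq by simp
    then show ?thesis
      by (intro curve[of "\<lambda>t. (mat 1, vector [vector [of_real (cos (1 / 2 * t)), - of_real (sin (1 / 2 * t))], vector [of_real (sin (1 / 2 * t)), of_real (cos (1 / 2 * t))]])"
            "1 / 2" "(0, vector [vector [0, - 1], vector [1, 0]])" 0 0 "(mat 1, 0)" "(0, mat 1)" 0])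
         (simp add: G_def, simp_all add: 7 simps)
  next
    case 8
    have "(vector [vector [cis (- (1 / 2 * t)), 0], vector [0, cis (1 / 2 * t)]] :: complex^2^2) \<in> SU" for t
      using SU_2[of "cis (- (1 / 2 * t))" 0] by (simp add: cis_mult cis_cnj)
    then show ?thesis
      by (intro curve[of "\<lambda>t. (mat 1, vector [vector [cis (- (1 / 2 * t)), 0], vector [0, cis (1 / 2 * t)]])"
            "1 / 2" "(0, vector [vector [- \<i>, 0], vector [0, \<i>]])" 0 0 "(mat 1, 0)" "(0, mat 1)" 0])
         (simp add: G_def, simp_all add: 8 simps)
  qed
qed

text \<open>The curve \<open>t \<mapsto> a \<gamma>(t)\<close> stays in \<open>G\<close> and has velocity \<open>a e\<^sub>i\<close>, which determines the derivative there.\<close>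

lemma derivative_within_G_unique:
  assumes D: "(f has_derivative D) (at a within G)" and D': "(f has_derivative D') (at a within G)"
    and a: "a \<in> G" and x: "x \<in> \<mm>"
  shows "D (gmul a x) = D' (gmul a x)"
proof -
  have lin: "linear (\<lambda>x. D (gmul a x))" "linear (\<lambda>x. D' (gmul a x))"
    using linear_compose[OF bounded_linear.linear[OF gmul.bounded_linear_right] has_derivative_linear[OF D]]
      linear_compose[OF bounded_linear.linear[OF gmul.bounded_linear_right] has_derivative_linear[OF D']]
    by (simp_all add: o_def)
  have "D (gmul a y) = D' (gmul a y)" if y: "y \<in> e ` {1..8}" for y
  proof -
    obtain i where i: "i \<in> {1..8}" "y = e i"
      using y by blast
    obtain \<gamma> where \<gamma>: "\<gamma> 0 = gone" "\<And>t. \<gamma> t \<in> G" "(\<gamma> has_vector_derivative y) (at (0::real))"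
      using curve_e[OF i(1)] i(2) by blast
    let ?c = "\<lambda>t. gmul a (\<gamma> t)"
    have c: "(?c has_derivative (\<lambda>t. gmul a (t *\<^sub>R y))) (at 0)"
      using \<gamma>(3) unfolding has_vector_derivative_def
      by (rule bounded_linear.has_derivative[OF gmul.bounded_linear_right])
    have *: "(f \<circ> ?c has_derivative E \<circ> (\<lambda>t. gmul a (t *\<^sub>R y))) (at 0)"
      if "(f has_derivative E) (at a within G)" for E
    proof (rule diff_chain_within[OF c])
      have "?c ` UNIV \<subseteq> G"
        using \<gamma>(2) gmul_in_G[OF a] by blast
      then show "(f has_derivative E) (at (?c 0) within ?c ` UNIV)"
        using has_derivative_subset[OF that] \<gamma>(1) by simp
    qed
    have "D \<circ> (\<lambda>t. gmul a (t *\<^sub>R y)) = D' \<circ> (\<lambda>t. gmul a (t *\<^sub>R y))"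
      by (rule has_derivative_unique[OF *[OF D] *[OF D']])
    from fun_cong[OF this, of 1] show ?thesis
      by simp
  qed
  then show ?thesis
    using linear_eq_on_span[OF lin] x unfolding \<mm>_def by blast
qed

section \<open>The canonical connection\<close>

declare split_paired_All [simp del] split_paired_Ex [simp del]

lemma vector_fieldsD:
  assumes "X \<in> vector_fields"
  shows "smooth_G X" "a \<notin> G \<Longrightarrow> X a = 0" "X a \<in> \<mm>"
    "a \<in> G \<Longrightarrow> h \<in> H \<Longrightarrow> X (gmul a h) = ad (star h) (X a)"
proof -
  show "smooth_G X" "a \<notin> G \<Longrightarrow> X a = 0"
    using assms by (simp_all add: vector_fields_def)
  then show "X a \<in> \<mm>"
    using assms subspace_0[OF subspace_m] by (cases "a \<in> G") (simp_all add: vector_fields_def)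
  show "X (gmul a h) = ad (star h) (X a)" if "a \<in> G" "h \<in> H"
  proof -
    have "h \<in> G"
      using that H_subset_G by auto
    then show ?thesis
      using assms that Ad_eq_ad[OF star_in_G] by (simp add: vector_fields_def ginv_eq_star)
  qed
qed

lemma vector_fieldsI:
  assumes "smooth_G X" "\<And>a. a \<notin> G \<Longrightarrow> X a = 0" "\<And>a. a \<in> G \<Longrightarrow> X a \<in> \<mm>"
    "\<And>a h. a \<in> G \<Longrightarrow> h \<in> H \<Longrightarrow> X (gmul a h) = ad (star h) (X a)"
  shows "X \<in> vector_fields"
proof -
  have "Ad (ginv h) = ad (star h)" if "h \<in> H" for h
    using that H_subset_G by (simp add: subsetD ginv_eq_star Ad_eq_ad star_in_G)
  then show ?thesis
    using assms by (simp add: vector_fields_def)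
qed

lemma lift_eq: "lift X a = gmul a (- X a)"
  by (simp add: lift_def gmul.minus_right)

text \<open>The derivative selected in \<open>along\<close> is an arbitrary one. Since a horizontal
  lift is \<open>a\<close> times an element of \<open>\<mm>\<close>, any other derivative within
  \<open>G\<close> gives the same value there, so the most convenient one may be used.\<close>

lemma along_eq:
  assumes "(f has_derivative D) (at a within G)" "a \<in> G" "X \<in> vector_fields"
  shows "along X f a = D (lift X a)"
proof -
  have "(f has_derivative frechet_derivative f (at a within G)) (at a within G)"
    using assms(1) differentiableI frechet_derivative_works by blast
  moreover have "- X a \<in> \<mm>"
    using vector_fieldsD(3)[OF assms(3)] subspace_neg[OF subspace_m] by blast
  ultimately show ?thesis
    unfolding along_def lift_eq using derivative_within_G_unique assms(1,2) by blast
qed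

lemma smooth_G_lift:
  assumes "X \<in> vector_fields"
  shows "smooth_G (lift X)"
proof -
  have "smooth_G (\<lambda>a. - gmul a (X a))"
    using vector_fieldsD(1)[OF assms]
    by (intro smooth_G_linear[OF bounded_linear_minus[OF bounded_linear_ident]]
        smooth_G_bilinear[OF bounded_bilinear_gmul] smooth_G_ident)
  moreover have "lift X = (\<lambda>a. - gmul a (X a))"
    by (simp add: lift_def fun_eq_iff)
  ultimately show ?thesis
    by simp
qed

text \<open>Smoothness is controlled for derivatives of an ambient extension in fixed directions.
  The varying direction \<open>lift X a\<close> is therefore expanded in the standard basis, with
  coefficients that are smooth themselves.\<close>

lemma smooth_G_along:
  assumes "smooth_G f" "X \<in> vector_fields"
  shows "smooth_G (along X f)"
proof -
  obtain U F where U: "open U" "G \<subseteq> U" "\<And>k. Ck_on k U F" "\<And>a. a \<in> G \<Longrightarrow> F a = f a"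
    using assms(1) unfolding smooth_G_def by blast
  let ?D = "\<lambda>a. frechet_derivative F (at a)"
  have D: "(F has_derivative ?D a) (at a)" if "a \<in> G" for a
    using U(2) that by (blast intro: Ck_on_has_derivative[OF U(3)])
  have "Ck_on k U (\<lambda>a. ?D a b)" for k b
    using U(3)[of "Suc k"] by simp
  then have s: "smooth_G (\<lambda>a. ?D a b)" for b
    unfolding smooth_G_def using U(1,2) by blast
  have "(\<Sum>b\<in>Basis. (lift X a \<bullet> b) *\<^sub>R ?D a b) = along X f a" if a: "a \<in> G" for a
  proof -
    have "(f has_derivative ?D a) (at a within G)"
      using U(4) by (intro has_derivative_transform[OF a, of f F] has_derivative_at_withinI[OF D[OF a]]) simp_all
    then have "along X f a = ?D a (lift X a)"
      using a assms(2) by (rule along_eq)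
    also have "\<dots> = ?D a (\<Sum>b\<in>Basis. (lift X a \<bullet> b) *\<^sub>R b)"
      by (simp only: euclidean_representation)
    also have "\<dots> = (\<Sum>b\<in>Basis. (lift X a \<bullet> b) *\<^sub>R ?D a b)"
      using has_derivative_linear[OF D[OF a]] by (simp only: linear_sum linear_scale)
    finally show ?thesis
      by simp
  qed
  moreover have "smooth_G (\<lambda>a. \<Sum>b\<in>Basis. (lift X a \<bullet> b) *\<^sub>R ?D a b)"
    by (intro smooth_G_sum smooth_G_bilinear[OF bounded_bilinear_scaleR] s
        smooth_G_linear[OF bounded_linear_inner_left] smooth_G_lift assms)
  ultimately show ?thesis
    by (rule smooth_G_cong)
qed

lemma canonical_connection_eq: "canonical_connection X Y a = (if a \<in> G then along X Y a else 0)"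
  by (simp add: canonical_connection_def nomizu_connection_def)

text \<open>Values stay in \<open>\<mm>\<close> because \<open>Y\<close> is fixed by the linear map
  \<open>proj\<close>. Equivariance comes from differentiating \<open>Y\<close> after right
  translation by \<open>h\<close> in two ways, by the chain rule and by the equivariance of
  \<open>Y\<close>.\<close>

lemma along_vector_field:
  assumes X: "X \<in> vector_fields" and Y: "Y \<in> vector_fields" and a: "a \<in> G"
  shows "along X Y a \<in> \<mm>" and "h \<in> H \<Longrightarrow> along X Y (gmul a h) = ad (star h) (along X Y a)"
proof -
  let ?D = "\<lambda>b. frechet_derivative Y (at b within G)"
  have D: "(Y has_derivative ?D b) (at b within G)" if "b \<in> G" for b
    using smooth_G_has_derivative[OF vector_fieldsD(1)[OF Y] that] .
  have "((\<lambda>b. proj (Y b)) has_derivative (\<lambda>v. proj (?D a v))) (at a within G)"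
    by (rule bounded_linear.has_derivative[OF bounded_linear_proj D[OF a]])
  moreover have "(\<lambda>b. proj (Y b)) = Y"
    using proj_id[OF vector_fieldsD(3)[OF Y]] by (rule ext)
  ultimately have "along X Y a = proj (?D a (lift X a))"
    using along_eq[OF _ a X] by metis
  then show "along X Y a \<in> \<mm>"
    by simp
  assume h: "h \<in> H"
  then have hG: "h \<in> G" and ah: "gmul a h \<in> G"
    using H_subset_G gmul_in_G[OF a] by blast+
  let ?R = "\<lambda>b. gmul b h"
  have "(Y \<circ> ?R has_derivative ?D (gmul a h) \<circ> ?R) (at a within G)"
  proof (rule diff_chain_within)
    show "(?R has_derivative ?R) (at a within G)"
      by (rule bounded_linear.has_derivative[OF gmul.bounded_linear_left has_derivative_ident])
    have "?R ` G \<subseteq> G"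
      using gmul_in_G hG by blast
    then show "(Y has_derivative ?D (gmul a h)) (at (gmul a h) within ?R ` G)"
      using D[OF ah] has_derivative_subset by blast
  qed
  then have "along X (Y \<circ> ?R) a = ?D (gmul a h) (gmul (lift X a) h)"
    using along_eq[OF _ a X] by fastforce
  moreover have "((\<lambda>b. ad (star h) (Y b)) has_derivative (\<lambda>v. ad (star h) (?D a v))) (at a within G)"
    by (rule bounded_linear.has_derivative[OF linear_ad[unfolded linear_conv_bounded_linear] D[OF a]])
  then have "(Y \<circ> ?R has_derivative (\<lambda>v. ad (star h) (?D a v))) (at a within G)"
    by (rule has_derivative_transform[OF a, rotated]) (simp add: vector_fieldsD(4)[OF Y _ h])
  then have "along X (Y \<circ> ?R) a = ad (star h) (?D a (lift X a))"
    using a X by (rule along_eq)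
  \<comment> \<open>Horizontal lifts are invariant under right translation by \<open>H\<close>: the
    factor \<open>h\<close> from the point cancels against the \<open>star h\<close> from
    equivariance.\<close>
  moreover have "lift X (gmul a h) = gmul (lift X a) h"
    using vector_fieldsD(4)[OF X a h] gmul_star_cancel[OF hG]
    by (simp add: lift_def ad_def gmul_assoc gmul.minus_left)
  ultimately show "along X Y (gmul a h) = ad (star h) (along X Y a)"
    by (simp add: along_def)
qed

lemma canonical_connection_vector_field:
  assumes X: "X \<in> vector_fields" and Y: "Y \<in> vector_fields"
  shows "canonical_connection X Y \<in> vector_fields"
proof (rule vector_fieldsI)
  show "smooth_G (canonical_connection X Y)"
    by (rule smooth_G_cong[OF _ smooth_G_along[OF vector_fieldsD(1)[OF Y] X]])
       (simp add: canonical_connection_eq)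
next
  fix a h assume "a \<in> G" "h \<in> H"
  moreover from this have "gmul a h \<in> G"
    using gmul_in_G H_subset_G by blast
  ultimately show "canonical_connection X Y (gmul a h) = ad (star h) (canonical_connection X Y a)"
    using along_vector_field(2)[OF X Y] by (simp add: canonical_connection_eq)
qed (use along_vector_field(1)[OF X Y] in \<open>simp_all add: canonical_connection_eq\<close>)

lemma is_connection_canonical: "is_connection canonical_connection"
  unfolding is_connection_def
proof (intro conjI ballI ext)
  fix X Y assume "X \<in> vector_fields" "Y \<in> vector_fields"
  then show "canonical_connection X Y \<in> vector_fields"
    by (rule canonical_connection_vector_field)
next
  fix X X' Y a assume "X \<in> vector_fields" "X' \<in> vector_fields" "Y \<in> vector_fields"
  then show "canonical_connection (\<lambda>a. X a + X' a) Y a = canonical_connection X Y a + canonical_connection X' Y a"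
    using linear_add[OF has_derivative_linear[OF smooth_G_has_derivative[OF vector_fieldsD(1)[of Y]]]]
    by (simp add: canonical_connection_eq along_def lift_eq gmul.diff_right gmul.minus_right)
      (metis (no_types, lifting) add_uminus_conv_diff)
next
  fix X Y Y' a assume *: "X \<in> vector_fields" "Y \<in> vector_fields" "Y' \<in> vector_fields"
  show "canonical_connection X (\<lambda>a. Y a + Y' a) a = canonical_connection X Y a + canonical_connection X Y' a"
  proof (cases "a \<in> G")
    case True
    show ?thesis
      using along_eq[OF has_derivative_add[OF smooth_G_has_derivative[OF vector_fieldsD(1)[OF *(2)] True]
            smooth_G_has_derivative[OF vector_fieldsD(1)[OF *(3)] True]] True *(1)] True
      by (simp add: canonical_connection_eq along_def)
  qed (simp add: canonical_connection_eq)
next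
  fix f X Y a assume *: "f \<in> smooth_functions" "X \<in> vector_fields" "Y \<in> vector_fields"
  show "canonical_connection (\<lambda>a. f a *\<^sub>R X a) Y a = f a *\<^sub>R canonical_connection X Y a"
  proof (cases "a \<in> G")
    case True
    have "lift (\<lambda>a. f a *\<^sub>R X a) a = f a *\<^sub>R lift X a"
      by (simp add: lift_def gmul.scaleR_right)
    then show ?thesis
      using linear_scale[OF has_derivative_linear[OF smooth_G_has_derivative[OF vector_fieldsD(1)[OF *(3)] True]]] True
      by (simp add: canonical_connection_eq along_def)
  qed (simp add: canonical_connection_eq)
next
  fix f X Y a assume *: "f \<in> smooth_functions" "X \<in> vector_fields" "Y \<in> vector_fields"
  show "canonical_connection X (\<lambda>a. f a *\<^sub>R Y a) a = along X f a *\<^sub>R Y a + f a *\<^sub>R canonical_connection X Y a"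
  proof (cases "a \<in> G")
    case True
    have "smooth_G f"
      using *(1) by (simp add: smooth_functions_def)
    then show ?thesis
      using along_eq[OF has_derivative_scaleR[OF smooth_G_has_derivative[OF _ True]
            smooth_G_has_derivative[OF vector_fieldsD(1)[OF *(3)] True]] True *(2)] True
      by (simp add: canonical_connection_eq along_def)
  next
    \<comment> \<open>Off \<open>G\<close> nothing is known about \<open>along X f a\<close>, but it
      is multiplied by \<open>Y a\<close>, which is zero there.\<close>
    case False
    then show ?thesis
      using vector_fieldsD(2)[OF *(3)] by (simp add: canonical_connection_eq)
  qed
qed

text \<open>Multilinearity enters only through the product rule. Stating that rule as a property of
  forms on lists of fixed length makes it closed under linear combinations, so that only single
  wedge products need a proof.\<close>

definition leibniz :: "nat \<Rightarrow> form \<Rightarrow> bool" where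
  "leibniz r \<phi> \<longleftrightarrow> (\<forall>(Fs :: (mat_pair \<Rightarrow> mat_pair) list) Fs' a S. length Fs = r \<longrightarrow>
     (\<forall>i<r. ((Fs ! i) has_derivative Fs' i) (at a within S)) \<longrightarrow>
     ((\<lambda>b. \<phi> (map (\<lambda>F. F b) Fs)) has_derivative
       (\<lambda>v. \<Sum>i<r. \<phi> ((map (\<lambda>F. F a) Fs)[i := Fs' i v]))) (at a within S))"

lemma leibnizD:
  fixes Fs :: "(mat_pair \<Rightarrow> mat_pair) list"
  assumes "leibniz r \<phi>" "length Fs = r" "\<And>i. i < r \<Longrightarrow> ((Fs ! i) has_derivative Fs' i) (at a within S)"
  shows "((\<lambda>b. \<phi> (map (\<lambda>F. F b) Fs)) has_derivative
    (\<lambda>v. \<Sum>i<r. \<phi> ((map (\<lambda>F. F a) Fs)[i := Fs' i v]))) (at a within S)"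
  using assms unfolding leibniz_def by simp

lemma leibnizI:
  assumes "\<And>(Fs :: (mat_pair \<Rightarrow> mat_pair) list) Fs' a S. length Fs = r \<Longrightarrow>
      (\<And>i. i < r \<Longrightarrow> ((Fs ! i) has_derivative Fs' i) (at a within S)) \<Longrightarrow>
      ((\<lambda>b. \<phi> (map (\<lambda>F. F b) Fs)) has_derivative
        (\<lambda>v. \<Sum>i<r. \<phi> ((map (\<lambda>F. F a) Fs)[i := Fs' i v]))) (at a within S)"
  shows "leibniz r \<phi>"
  using assms unfolding leibniz_def by simp

lemma leibniz_add:
  assumes "leibniz r \<phi>" "leibniz r \<psi>"
  shows "leibniz r (\<lambda>vs. \<phi> vs + \<psi> vs)"
  by (rule leibnizI, unfold sum.distrib, rule has_derivative_add; rule leibnizD; (rule assms | assumption | simp))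

lemma leibniz_scale:
  assumes "leibniz r \<phi>"
  shows "leibniz r (\<lambda>vs. c * \<phi> vs)"
  by (rule leibnizI, unfold sum_distrib_left[symmetric], rule has_derivative_mult_right; rule leibnizD;
      (rule assms | assumption | simp))

lemma leibniz_diff:
  assumes "leibniz r \<phi>" "leibniz r \<psi>"
  shows "leibniz r (\<lambda>vs. \<phi> vs - \<psi> vs)"
  by (rule leibnizI, unfold sum_subtractf, rule has_derivative_diff; rule leibnizD; (rule assms | assumption | simp))

lemma leibniz_wedge:
  assumes \<theta>: "\<And>i. bounded_linear (\<theta> i)" and r: "length is = r"
  shows "leibniz r (wedge \<theta> is)"
  unfolding leibniz_def
proof (intro allI impI)
  fix Fs :: "(mat_pair \<Rightarrow> mat_pair) list" and Fs' a S
  assume Fs: "length Fs = r" "\<forall>i<r. ((Fs ! i) has_derivative Fs' i) (at a within S)"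
  let ?P = "{p. p permutes {..<r}}"
  have p: "p k < r" if "p \<in> ?P" "k < r" for p k
    using that permutes_in_image[of p "{..<r}" k] by auto
  have "((\<lambda>b. \<Sum>p\<in>?P. of_int (sign p) * (\<Prod>k<r. \<theta> (is ! k) ((Fs ! p k) b))) has_derivative
      (\<lambda>v. \<Sum>p\<in>?P. of_int (sign p) *
        (\<Sum>k<r. \<theta> (is ! k) (Fs' (p k) v) * (\<Prod>j\<in>{..<r} - {k}. \<theta> (is ! j) ((Fs ! p j) a))))) (at a within S)"
    using Fs p by (intro has_derivative_sum has_derivative_mult_right has_derivative_prod
        bounded_linear.has_derivative[OF \<theta>]) simp
  moreover have "wedge \<theta> is (map (\<lambda>F. F b) Fs) = (\<Sum>p\<in>?P. of_int (sign p) * (\<Prod>k<r. \<theta> (is ! k) ((Fs ! p k) b)))" for b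
    unfolding wedge_def r using p Fs(1) by (intro sum.cong arg_cong2[of _ _ _ _ "(*)"] prod.cong refl) simp
  moreover have "(\<Sum>i<r. wedge \<theta> is ((map (\<lambda>F. F a) Fs)[i := Fs' i v])) = (\<Sum>p\<in>?P. of_int (sign p) *
        (\<Sum>k<r. \<theta> (is ! k) (Fs' (p k) v) * (\<Prod>j\<in>{..<r} - {k}. \<theta> (is ! j) ((Fs ! p j) a))))" for v
  proof -
    have "(\<Sum>i<r. wedge \<theta> is ((map (\<lambda>F. F a) Fs)[i := Fs' i v])) =
        (\<Sum>p\<in>?P. of_int (sign p) * (\<Sum>i<r. \<Prod>k<r. \<theta> (is ! k) ((map (\<lambda>F. F a) Fs)[i := Fs' i v] ! p k)))"
      unfolding wedge_def r sum_distrib_left by (rule sum.swap)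
    also have "\<dots> = (\<Sum>p\<in>?P. of_int (sign p) *
        (\<Sum>k<r. \<theta> (is ! k) (Fs' (p k) v) * (\<Prod>j\<in>{..<r} - {k}. \<theta> (is ! j) ((Fs ! p j) a))))"
    proof (rule sum.cong[OF refl], rule arg_cong2[of _ _ _ _ "(*)", OF refl])
      fix q assume q: "q \<in> ?P"
      let ?L = "\<lambda>i. (map (\<lambda>F. F a) Fs)[i := Fs' i v]"
      \<comment> \<open>For a fixed permutation, the factor that sees the replaced argument in slot
        \<open>i\<close> is the one whose index \<open>q\<close> maps to \<open>i\<close>. Summing
        over that index instead produces the usual product rule.\<close>
      have "(\<Sum>i<r. \<Prod>k<r. \<theta> (is ! k) (?L i ! q k)) = (\<Sum>l<r. \<Prod>k<r. \<theta> (is ! k) (?L (q l) ! q k))"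
        using q by (intro sum.reindex_bij_betw[symmetric] permutes_imp_bij) simp
      also have "\<dots> = (\<Sum>k<r. \<theta> (is ! k) (Fs' (q k) v) * (\<Prod>j\<in>{..<r} - {k}. \<theta> (is ! j) ((Fs ! q j) a)))"
      proof (rule sum.cong)
        fix l assume l: "l \<in> {..<r}"
        have "(\<Prod>k<r. \<theta> (is ! k) (?L (q l) ! q k)) =
            \<theta> (is ! l) (?L (q l) ! q l) * (\<Prod>k\<in>{..<r} - {l}. \<theta> (is ! k) (?L (q l) ! q k))"
          using l by (intro prod.remove) simp_all
        also have "(\<Prod>k\<in>{..<r} - {l}. \<theta> (is ! k) (?L (q l) ! q k)) = (\<Prod>j\<in>{..<r} - {l}. \<theta> (is ! j) ((Fs ! q j) a))"
        proof (rule prod.cong)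
          fix j assume j: "j \<in> {..<r} - {l}"
          then have "q j \<noteq> q l"
            using q permutes_inj[of q "{..<r}"] by (auto dest: injD)
          then show "\<theta> (is ! j) (?L (q l) ! q j) = \<theta> (is ! j) ((Fs ! q j) a)"
            using p[OF q] j Fs(1) by simp
        qed simp
        finally show "(\<Prod>k<r. \<theta> (is ! k) (?L (q l) ! q k)) =
            \<theta> (is ! l) (Fs' (q l) v) * (\<Prod>j\<in>{..<r} - {l}. \<theta> (is ! j) ((Fs ! q j) a))"
          using p[OF q] l Fs(1) by simp
      qed simp
      finally show "(\<Sum>i<r. \<Prod>k<r. \<theta> (is ! k) (?L i ! q k)) =
          (\<Sum>k<r. \<theta> (is ! k) (Fs' (q k) v) * (\<Prod>j\<in>{..<r} - {k}. \<theta> (is ! j) ((Fs ! q j) a)))" .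
    qed
    finally show ?thesis .
  qed
  ultimately show "((\<lambda>b. wedge \<theta> is (map (\<lambda>F. F b) Fs)) has_derivative
      (\<lambda>v. \<Sum>i<r. wedge \<theta> is ((map (\<lambda>F. F a) Fs)[i := Fs' i v]))) (at a within S)"
    by presburger
qed

lemma leibniz_spin7: "leibniz 4 (spin7_normal_form coord)"
proof -
  have "leibniz 4 (\<lambda>vs. spin7_normal_form coord vs)"
    unfolding spin7_normal_form_def
    by (intro leibniz_add leibniz_diff leibniz_wedge bounded_linear_coord) simp_all
  then show ?thesis
    by simp
qed

lemma leibniz_torsion_3form: "leibniz 3 (\<lambda>vs.
    - sqrt 3 * (wedge coord [1, 2, 5] vs - wedge coord [3, 4, 5] vs) + wedge coord [6, 7, 8] vs)"
  by (intro leibniz_add leibniz_scale leibniz_diff leibniz_wedge bounded_linear_coord) simp_all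

lemma lessThan_2: "{..<2::nat} = {0, 1}"
  by auto

lemma leibniz_std_metric: "leibniz 2 (\<lambda>vs. \<Sum>i\<in>{1..8}. coord i (vs ! 0) * coord i (vs ! 1))"
  unfolding leibniz_def
proof (intro allI impI)
  fix Fs :: "(mat_pair \<Rightarrow> mat_pair) list" and Fs' a S
  assume Fs: "length Fs = 2" "\<forall>i<2. ((Fs ! i) has_derivative Fs' i) (at a within S)"
  then obtain F F' where l: "Fs = [F, F']"
    by (auto simp: length_eq_2)
  have F: "(F has_derivative Fs' 0) (at a within S)" "(F' has_derivative Fs' 1) (at a within S)"
    using Fs(2)[rule_format, of 0] Fs(2)[rule_format, of 1] l by simp_all
  have "((\<lambda>b. \<Sum>i\<in>{1..8}. coord i (F b) * coord i (F' b)) has_derivative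
      (\<lambda>v. \<Sum>i\<in>{1..8}. coord i (F a) * coord i (Fs' 1 v) + coord i (Fs' 0 v) * coord i (F' a))) (at a within S)"
    by (intro has_derivative_sum has_derivative_mult bounded_linear.has_derivative[OF bounded_linear_coord] F)
  then show "((\<lambda>b. \<Sum>i\<in>{1..8}. coord i (map (\<lambda>F. F b) Fs ! 0) * coord i (map (\<lambda>F. F b) Fs ! 1)) has_derivative
      (\<lambda>v. \<Sum>k<2. \<Sum>i\<in>{1..8}. coord i ((map (\<lambda>F. F a) Fs)[k := Fs' k v] ! 0)
        * coord i ((map (\<lambda>F. F a) Fs)[k := Fs' k v] ! 1))) (at a within S)"
    by (simp add: l lessThan_2 One_nat_def sum.distrib add.commute)
qed

text \<open>The canonical connection differentiates functions with values in \<open>\<mm>\<close>,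
  so a form with constant coefficients satisfies the product rule with no remainder. Here
  \<open>\<psi>\<close> is an ambient version that can be differentiated, and it need only agree
  with \<open>\<phi>\<close> on \<open>\<mm>\<close>.\<close>

lemma parallel_canonical:
  assumes \<psi>: "leibniz r \<psi>" and eq: "\<And>vs. length vs = r \<Longrightarrow> set vs \<subseteq> \<mm> \<Longrightarrow> \<phi> vs = \<psi> vs"
  shows "parallel canonical_connection r (invariant_tensor \<phi>)"
  unfolding parallel_def
proof (intro ballI allI impI, elim conjE)
  fix W Xs a
  assume W: "W \<in> vector_fields" and Xs: "length Xs = r" "set Xs \<subseteq> vector_fields" and a: "a \<in> G"
  let ?D = "\<lambda>i. frechet_derivative (Xs ! i) (at a within G)"
  have m: "set (map (\<lambda>X. X b) Xs) \<subseteq> \<mm>" for b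
    using Xs(2) vector_fieldsD(3) by fastforce
  have Xi: "Xs ! i \<in> vector_fields" if "i < r" for i
    using that Xs nth_mem by blast
  then have "((\<lambda>b. \<psi> (map (\<lambda>X. X b) Xs)) has_derivative
      (\<lambda>v. \<Sum>i<r. \<psi> ((map (\<lambda>X. X a) Xs)[i := ?D i v]))) (at a within G)"
    by (intro leibnizD[OF \<psi> Xs(1)] smooth_G_has_derivative[OF vector_fieldsD(1) a])
  moreover have "invariant_tensor \<phi> Xs = (\<lambda>b. \<psi> (map (\<lambda>X. X b) Xs))"
    using eq[OF _ m] Xs(1) by (simp add: invariant_tensor_def fun_eq_iff)
  ultimately have "along W (invariant_tensor \<phi> Xs) a = (\<Sum>i<r. \<psi> ((map (\<lambda>X. X a) Xs)[i := ?D i (lift W a)]))"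
    using along_eq[OF _ a W] by simp
  also have "\<dots> = (\<Sum>i<r. invariant_tensor \<phi> (Xs[i := canonical_connection W (Xs ! i)]) a)"
  proof (rule sum.cong)
    fix i assume "i \<in> {..<r}"
    then have "?D i (lift W a) \<in> \<mm>"
      using along_vector_field(1)[OF W Xi a] by (simp add: along_def)
    then have "set ((map (\<lambda>X. X a) Xs)[i := ?D i (lift W a)]) \<subseteq> \<mm>"
      using m[of a] by (intro set_update_subsetI)
    then show "\<psi> ((map (\<lambda>X. X a) Xs)[i := ?D i (lift W a)]) =
        invariant_tensor \<phi> (Xs[i := canonical_connection W (Xs ! i)]) a"
      using a Xs(1) by (simp add: invariant_tensor_def map_update canonical_connection_eq along_def eq)
  qed simp
  finally show "cov_deriv canonical_connection W (invariant_tensor \<phi>) Xs a = 0"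
    by (simp add: cov_deriv_def Xs(1))
qed

text \<open>Differentiating - b Y(b) along the lift of \<open>X\<close> gives a X Y - a (along X Y).
  Antisymmetrizing, the bracket of the lifts translated back to the identity is [X, Y] minus the
  antisymmetrized derivative; the outer minus sign in \<open>lie_bracket\<close> then leaves +
  [X, Y] projected to \<open>\<mm>\<close>.\<close>

lemma torsion_canonical:
  assumes X: "X \<in> vector_fields" and Y: "Y \<in> vector_fields" and a: "a \<in> G"
  shows "torsion canonical_connection X Y a = proj (bracket (X a) (Y a))"
proof -
  have l: "along X (lift Y) a = gmul a (gmul (X a) (Y a)) - gmul a (along X Y a)"
    if X: "X \<in> vector_fields" and Y: "Y \<in> vector_fields" for X Y
  proof -
    have "((\<lambda>b. - gmul b (Y b)) has_derivative
        (\<lambda>v. - (gmul a (frechet_derivative Y (at a within G) v) + gmul v (Y a)))) (at a within G)"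
      by (intro has_derivative_minus gmul.FDERIV has_derivative_ident smooth_G_has_derivative vector_fieldsD(1) Y a)
    moreover have "lift Y = (\<lambda>b. - gmul b (Y b))"
      by (simp add: lift_def fun_eq_iff)
    ultimately have "along X (lift Y) a = - (gmul a (along X Y a) + gmul (lift X a) (Y a))"
      using along_eq[OF _ a X] by (simp add: along_def)
    then show ?thesis
      by (simp add: lift_def gmul.minus_left gmul_assoc)
  qed
  have "along X (lift Y) a - along Y (lift X) a = gmul a (bracket (X a) (Y a) - (along X Y a - along Y X a))"
    by (simp add: l X Y bracket_def gmul.diff_right)
  then have "gmul (ginv a) (along X (lift Y) a - along Y (lift X) a) =
      bracket (X a) (Y a) - (along X Y a - along Y X a)"
    by (simp add: ginv_eq_star[OF a] gmul_star_cancel[OF a])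
  moreover have d: "along X Y a - along Y X a \<in> \<mm>"
    using X Y a along_vector_field(1) by (intro subspace_diff[OF subspace_m])
  moreover have "bracket (X a) (Y a) - (along X Y a - along Y X a) \<in> lie_G"
    using vector_fieldsD(3)[OF X] vector_fieldsD(3)[OF Y] d
    by (intro subspace_diff[OF subspace_lie_G] bracket_lie_G m_in_lie_G)
  ultimately show ?thesis
    using a proj_id[OF d]
    by (simp add: torsion_def lie_bracket_def canonical_connection_eq m_part_eq_proj linear_diff[OF linear_proj])
qed

lemma torsion_tensor_canonical:
  assumes "X \<in> vector_fields" "Y \<in> vector_fields" "Z \<in> vector_fields" "a \<in> G"
  shows "torsion_tensor std_metric canonical_connection [X, Y, Z] a = torsion_3form [X a, Y a, Z a]"
  using assms vector_fieldsD(3)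
  by (simp add: torsion_tensor_def torsion_canonical torsion_3form_bracket)

lemma characteristic_canonical: "characteristic_connection \<Phi> std_metric canonical_connection"
proof -
  have "parallel canonical_connection 2 (invariant_tensor std_metric)"
    by (rule parallel_canonical[OF leibniz_std_metric]) (auto simp: length_eq_2 std_metric_coord)
  moreover have "parallel canonical_connection 4 (invariant_tensor \<Phi>)"
    by (rule parallel_canonical[OF leibniz_spin7 \<Phi>_coord])
  moreover have "skew_torsion std_metric canonical_connection"
    unfolding skew_torsion_def
  proof (intro ballI)
    fix X Y Z a assume "X \<in> vector_fields" "Y \<in> vector_fields" "Z \<in> vector_fields" "a \<in> G"
    then show "torsion_tensor std_metric canonical_connection [X, Y, Z] a =
          - torsion_tensor std_metric canonical_connection [Y, X, Z] a \<and>
        torsion_tensor std_metric canonical_connection [X, Y, Z] a =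
          - torsion_tensor std_metric canonical_connection [X, Z, Y] a"
      using torsion_3form_skew[of "X a" "Y a" "Z a"] by (simp add: torsion_tensor_canonical vector_fieldsD(3))
  qed
  ultimately show ?thesis
    by (simp add: characteristic_connection_def is_connection_canonical)
qed

section \<open>Uniqueness of the characteristic connection\<close>

text \<open>The seven equations involve each of the 28 index pairs exactly once; they cut
  \<open>so(8)\<close> down to dimension 21, which is \<open>spin(7)\<close>. After subtracting 1
  from the indices and reading them in binary, the pairs of one equation share their bitwise sum.
  Hence contraction with \<open>i\<close> relates only triples with one common bitwise sum, and the
  term whose pair contains \<open>i\<close> drops out. This sum, with its eight values, sorts the
  unknowns and selects the equations to combine.\<close>

lemma three_form_eq_0_if_contractions_in_spin7:
  fixes b :: "nat \<Rightarrow> nat \<Rightarrow> nat \<Rightarrow> real"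
  assumes skew: "\<And>i j k. i \<in> {1..8} \<Longrightarrow> j \<in> {1..8} \<Longrightarrow> k \<in> {1..8} \<Longrightarrow> b i j k = - b i k j"
      "\<And>i j k. i \<in> {1..8} \<Longrightarrow> j \<in> {1..8} \<Longrightarrow> k \<in> {1..8} \<Longrightarrow> b i j k = - b j i k"
    and eq: "\<And>i. i \<in> {1..8} \<Longrightarrow> b i 1 8 + b i 2 7 - b i 3 6 + b i 5 4 = 0"
      "\<And>i. i \<in> {1..8} \<Longrightarrow> - b i 1 7 + b i 2 8 + b i 3 5 + b i 6 4 = 0"
      "\<And>i. i \<in> {1..8} \<Longrightarrow> b i 1 6 - b i 2 5 + b i 3 8 + b i 7 4 = 0"
      "\<And>i. i \<in> {1..8} \<Longrightarrow> - b i 1 5 - b i 2 6 - b i 3 7 + b i 8 4 = 0"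
      "\<And>i. i \<in> {1..8} \<Longrightarrow> - b i 1 4 + b i 2 3 + b i 5 8 + b i 7 6 = 0"
      "\<And>i. i \<in> {1..8} \<Longrightarrow> b i 1 3 + b i 2 4 - b i 5 7 + b i 8 6 = 0"
      "\<And>i. i \<in> {1..8} \<Longrightarrow> - b i 1 2 + b i 3 4 + b i 5 6 + b i 8 7 = 0"
    and ijk: "i \<in> {1..8}" "j \<in> {1..8}" "k \<in> {1..8}"
  shows "b i j k = 0"
proof -
  \<comment> \<open>Extension by zero makes skewness hold for all indices, so it can serve as
    rewriting without side conditions on ranges.\<close>
  define c where "c i j k = (if {i, j, k} \<subseteq> {1..8} then b i j k else 0)" for i j k
  have skew': "c i j k = - c i k j" "c i j k = - c j i k" for i j k
    using skew(1)[of i j k] skew(2)[of i j k] by (simp_all add: c_def)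
  have eq': "c i 1 8 + c i 2 7 - c i 3 6 + c i 5 4 = 0"
      "- c i 1 7 + c i 2 8 + c i 3 5 + c i 6 4 = 0"
      "c i 1 6 - c i 2 5 + c i 3 8 + c i 7 4 = 0"
      "- c i 1 5 - c i 2 6 - c i 3 7 + c i 8 4 = 0"
      "- c i 1 4 + c i 2 3 + c i 5 8 + c i 7 6 = 0"
      "c i 1 3 + c i 2 4 - c i 5 7 + c i 8 6 = 0"
      "- c i 1 2 + c i 3 4 + c i 5 6 + c i 8 7 = 0" for i
    using eq[of i] by (simp_all add: c_def)
  \<comment> \<open>Oriented so that rewriting brings numeral indices into increasing order and
    removes repeated ones.\<close>
  have sort: "k < j \<Longrightarrow> c i j k = - c i k j" "j < i \<Longrightarrow> c i j k = - c j i k" "c i i k = 0" "c i k k = 0" for i j k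
    using skew'(1)[of i j k] skew'(2)[of i j k] skew'(2)[of i i k] skew'(1)[of i k k] by simp_all
  txt \<open>The 56 coefficients split into eight blocks of seven, each with its own seven equations.\<close>
  have "c 1 2 3 + c 1 5 8 - c 1 6 7 = 0"
    "- c 1 2 3 - c 2 5 7 - c 2 6 8 = 0"
    "- c 1 2 3 + c 3 5 6 - c 3 7 8 = 0"
    "- c 1 5 8 - c 2 5 7 + c 3 5 6 = 0"
    "c 1 6 7 - c 2 6 8 + c 3 5 6 = 0"
    "c 1 6 7 - c 2 5 7 - c 3 7 8 = 0"
    "- c 1 5 8 - c 2 6 8 - c 3 7 8 = 0"
    using eq'(5)[of 1] eq'(6)[of 2] eq'(7)[of 3] eq'(1)[of 5] eq'(2)[of 6] eq'(3)[of 7] eq'(4)[of 8]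
    by (simp_all add: sort)
  then have z1: "c 1 2 3 = 0" "c 1 5 8 = 0" "c 1 6 7 = 0" "c 2 5 7 = 0" "c 2 6 8 = 0" "c 3 5 6 = 0" "c 3 7 8 = 0"
    by linarith+
  have "c 1 2 4 - c 1 5 7 - c 1 6 8 = 0"
    "c 1 2 4 + c 2 5 8 - c 2 6 7 = 0"
    "- c 1 2 4 + c 4 5 6 - c 4 7 8 = 0"
    "c 1 5 7 - c 2 5 8 + c 4 5 6 = 0"
    "- c 1 6 8 - c 2 6 7 - c 4 5 6 = 0"
    "- c 1 5 7 - c 2 6 7 + c 4 7 8 = 0"
    "c 1 6 8 - c 2 5 8 - c 4 7 8 = 0"
    using eq'(6)[of 1] eq'(5)[of 2] eq'(7)[of 4] eq'(2)[of 5] eq'(1)[of 6] eq'(4)[of 7] eq'(3)[of 8]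
    by (simp_all add: sort)
  then have z2: "c 1 2 4 = 0" "c 1 5 7 = 0" "c 1 6 8 = 0" "c 2 5 8 = 0" "c 2 6 7 = 0" "c 4 5 6 = 0" "c 4 7 8 = 0"
    by linarith+
  have "- c 1 2 5 + c 1 3 8 - c 1 4 7 = 0"
    "c 1 2 5 - c 2 3 7 - c 2 4 8 = 0"
    "- c 1 3 8 - c 2 3 7 - c 3 4 5 = 0"
    "c 1 4 7 - c 2 4 8 - c 3 4 5 = 0"
    "- c 1 2 5 + c 3 4 5 - c 5 7 8 = 0"
    "- c 1 4 7 + c 2 3 7 - c 5 7 8 = 0"
    "c 1 3 8 + c 2 4 8 - c 5 7 8 = 0"
    using eq'(3)[of 1] eq'(4)[of 2] eq'(1)[of 3] eq'(2)[of 4] eq'(7)[of 5] eq'(5)[of 7] eq'(6)[of 8]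
    by (simp_all add: sort)
  then have z3: "c 1 2 5 = 0" "c 1 3 8 = 0" "c 1 4 7 = 0" "c 2 3 7 = 0" "c 2 4 8 = 0" "c 3 4 5 = 0" "c 5 7 8 = 0"
    by linarith+
  have "- c 1 2 6 - c 1 3 7 - c 1 4 8 = 0"
    "- c 1 2 6 + c 2 3 8 - c 2 4 7 = 0"
    "c 1 3 7 - c 2 3 8 - c 3 4 6 = 0"
    "- c 1 4 8 - c 2 4 7 + c 3 4 6 = 0"
    "- c 1 2 6 + c 3 4 6 - c 6 7 8 = 0"
    "c 1 3 7 + c 2 4 7 + c 6 7 8 = 0"
    "- c 1 4 8 + c 2 3 8 - c 6 7 8 = 0"
    using eq'(4)[of 1] eq'(3)[of 2] eq'(2)[of 3] eq'(1)[of 4] eq'(7)[of 6] eq'(6)[of 7] eq'(5)[of 8]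
    by (simp_all add: sort)
  then have z4: "c 1 2 6 = 0" "c 1 3 7 = 0" "c 1 4 8 = 0" "c 2 3 8 = 0" "c 2 4 7 = 0" "c 3 4 6 = 0" "c 6 7 8 = 0"
    by linarith+
  have "c 1 2 7 - c 1 3 6 - c 1 4 5 = 0"
    "c 1 2 7 + c 2 3 5 - c 2 4 6 = 0"
    "- c 1 3 6 + c 2 3 5 - c 3 4 7 = 0"
    "c 1 4 5 + c 2 4 6 + c 3 4 7 = 0"
    "- c 1 4 5 + c 2 3 5 - c 5 6 7 = 0"
    "c 1 3 6 + c 2 4 6 + c 5 6 7 = 0"
    "- c 1 2 7 + c 3 4 7 + c 5 6 7 = 0"
    using eq'(1)[of 1] eq'(2)[of 2] eq'(3)[of 3] eq'(4)[of 4] eq'(5)[of 5] eq'(6)[of 6] eq'(7)[of 7]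
    by (simp_all add: sort)
  then have z5: "c 1 2 7 = 0" "c 1 3 6 = 0" "c 1 4 5 = 0" "c 2 3 5 = 0" "c 2 4 6 = 0" "c 3 4 7 = 0" "c 5 6 7 = 0"
    by linarith+
  have "c 1 2 8 + c 1 3 5 - c 1 4 6 = 0"
    "- c 1 2 8 - c 2 3 6 - c 2 4 5 = 0"
    "c 1 3 5 + c 2 3 6 - c 3 4 8 = 0"
    "- c 1 4 6 + c 2 4 5 - c 3 4 8 = 0"
    "c 1 3 5 + c 2 4 5 - c 5 6 8 = 0"
    "- c 1 4 6 + c 2 3 6 - c 5 6 8 = 0"
    "- c 1 2 8 + c 3 4 8 + c 5 6 8 = 0"
    using eq'(2)[of 1] eq'(1)[of 2] eq'(4)[of 3] eq'(3)[of 4] eq'(6)[of 5] eq'(5)[of 6] eq'(7)[of 8]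
    by (simp_all add: sort)
  then have z6: "c 1 2 8 = 0" "c 1 3 5 = 0" "c 1 4 6 = 0" "c 2 3 6 = 0" "c 2 4 5 = 0" "c 3 4 8 = 0" "c 5 6 8 = 0"
    by linarith+
  have "c 1 3 4 + c 1 5 6 - c 1 7 8 = 0"
    "c 1 3 4 + c 3 5 8 - c 3 6 7 = 0"
    "c 1 3 4 - c 4 5 7 - c 4 6 8 = 0"
    "- c 1 5 6 - c 3 5 8 + c 4 5 7 = 0"
    "- c 1 5 6 + c 3 6 7 + c 4 6 8 = 0"
    "- c 1 7 8 - c 3 6 7 - c 4 5 7 = 0"
    "- c 1 7 8 + c 3 5 8 - c 4 6 8 = 0"
    using eq'(7)[of 1] eq'(5)[of 3] eq'(6)[of 4] eq'(3)[of 5] eq'(4)[of 6] eq'(1)[of 7] eq'(2)[of 8]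
    by (simp_all add: sort)
  then have z7: "c 1 3 4 = 0" "c 1 5 6 = 0" "c 1 7 8 = 0" "c 3 5 8 = 0" "c 3 6 7 = 0" "c 4 5 7 = 0" "c 4 6 8 = 0"
    by linarith+
  have "c 2 3 4 + c 2 5 6 - c 2 7 8 = 0"
    "- c 2 3 4 - c 3 5 7 - c 3 6 8 = 0"
    "c 2 3 4 + c 4 5 8 - c 4 6 7 = 0"
    "c 2 5 6 + c 3 5 7 + c 4 5 8 = 0"
    "- c 2 5 6 - c 3 6 8 + c 4 6 7 = 0"
    "- c 2 7 8 + c 3 5 7 - c 4 6 7 = 0"
    "c 2 7 8 - c 3 6 8 - c 4 5 8 = 0"
    using eq'(7)[of 2] eq'(6)[of 3] eq'(5)[of 4] eq'(4)[of 5] eq'(3)[of 6] eq'(2)[of 7] eq'(1)[of 8]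
    by (simp_all add: sort)
  then have z8: "c 2 3 4 = 0" "c 2 5 6 = 0" "c 2 7 8 = 0" "c 3 5 7 = 0" "c 3 6 8 = 0" "c 4 5 8 = 0" "c 4 6 7 = 0"
    by linarith+
  have "\<forall>i\<in>{1..8}. \<forall>j\<in>{1..8}. \<forall>k\<in>{1..8}. i < j \<longrightarrow> j < k \<longrightarrow> c i j k = 0"
    unfolding atLeastAtMost_1_8 by (simp add: z1 z2 z3 z4 z5 z6 z7 z8)
  then have sorted: "c i j k = 0" if "i < j" "j < k" for i j k
    using that by (cases "{i, j, k} \<subseteq> {1..8}") (simp_all add: c_def)
  have increasing: "c i j k = 0" if "i < j" for i j k
    using sorted[of i j k] sorted[of i k j] sorted[of k i j] skew'(1)[of i j k] skew'(2)[of i k j] sort(3)[of i j]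
      sort(4)[of i j] that by (cases j k rule: linorder_cases; cases i k rule: linorder_cases) simp_all
  have "c i j k = 0"
    using increasing[of i j k] increasing[of j i k] skew'(2)[of i j k] sort(3)[of i k]
    by (cases i j rule: linorder_cases) simp_all
  then show ?thesis
    using ijk by (simp add: c_def)
qed

lemma minor_e:
  assumes "i \<in> {1..8}" "j \<in> {1..8}" "l \<in> {1..8}"
  shows "minor coord i j x (e l) = (if j = l then coord i x else 0) - (if i = l then coord j x else 0)"
    "minor coord i j (e l) x = (if i = l then coord j x else 0) - (if j = l then coord i x else 0)"
  using assms by (auto simp: minor_def coord_e simp del: atLeastAtMost_iff)

text \<open>None of the seven quadruples is the index set of a term of \<open>\<Phi>\<close>, but
  replacing any one index by its partner in a suitable perfect matching of the eight indices gives
  such a set. Hence exactly four coordinates survive. The quadruples represent the seven matchings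
  into which the 28 pairs split.\<close>

lemma \<Phi>_derivation:
  fixes u :: "nat \<Rightarrow> mat_pair"
  assumes u: "\<And>j. u j \<in> \<mm>"
  defines "sl p q r s \<equiv> \<Phi> [u p, e q, e r, e s] + \<Phi> [e p, u q, e r, e s] + \<Phi> [e p, e q, u r, e s] + \<Phi> [e p, e q, e r, u s]"
  shows "sl 1 2 3 5 = coord 8 (u 1) + coord 7 (u 2) - coord 6 (u 3) + coord 4 (u 5)"
    "sl 1 2 3 6 = - coord 7 (u 1) + coord 8 (u 2) + coord 5 (u 3) + coord 4 (u 6)"
    "sl 1 2 3 7 = coord 6 (u 1) - coord 5 (u 2) + coord 8 (u 3) + coord 4 (u 7)"
    "sl 1 2 3 8 = - coord 5 (u 1) - coord 6 (u 2) - coord 7 (u 3) + coord 4 (u 8)"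
    "sl 1 2 5 7 = - coord 4 (u 1) + coord 3 (u 2) + coord 8 (u 5) + coord 6 (u 7)"
    "sl 1 2 5 8 = coord 3 (u 1) + coord 4 (u 2) - coord 7 (u 5) + coord 6 (u 8)"
    "sl 1 3 5 8 = - coord 2 (u 1) + coord 4 (u 3) + coord 6 (u 5) + coord 7 (u 8)"
  unfolding sl_def
  by (simp_all add: u \<Phi>_coord spin7_normal_form_def wedge_4 wedge_pair_def minor_e coord_e)

text \<open>For \<open>\<xi>\<close> in the Lie algebra of \<open>G\<close> this is a fundamental vector field; allowing all matrix pairs
  makes the standard basis of the ambient space a finite set of global generators.\<close>

definition generator :: "mat_pair \<Rightarrow> mat_pair \<Rightarrow> mat_pair" where
  "generator \<xi> a = (if a \<in> G then proj (ad (star a) \<xi>) else 0)"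

text \<open>Transported by \<open>ad a\<close>, the value of a vector field depends only on the
  coset of \<open>a\<close>; its ambient components are therefore functions on the quotient.\<close>

definition coefficient :: "(mat_pair \<Rightarrow> mat_pair) \<Rightarrow> mat_pair \<Rightarrow> mat_pair \<Rightarrow> real" where
  "coefficient X \<xi> a = (if a \<in> G then ad a (X a) \<bullet> \<xi> else 0)"

lemma bounded_linear_star: "bounded_linear star"
  using linear_star by (simp add: linear_conv_bounded_linear)

lemma generator_vector_field: "generator \<xi> \<in> vector_fields"
proof (rule vector_fieldsI)
  have "smooth_G (\<lambda>a. proj (gmul (gmul (star a) \<xi>) a))"
    by (intro smooth_G_linear[OF bounded_linear_proj] smooth_G_bilinear[OF bounded_bilinear_gmul]
        smooth_G_linear[OF bounded_linear_star] smooth_G_ident smooth_G_const)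
  then show "smooth_G (generator \<xi>)"
    by (rule smooth_G_cong[rotated]) (simp add: generator_def ad_def)
next
  fix a h assume "a \<in> G" "h \<in> H"
  moreover from this have "gmul a h \<in> G"
    using gmul_in_G H_subset_G by blast
  ultimately show "generator \<xi> (gmul a h) = ad (star h) (generator \<xi> a)"
    by (simp add: generator_def star_gmul ad_gmul proj_ad star_in_H)
qed (simp_all add: generator_def)

lemma coefficient_smooth_function:
  assumes X: "X \<in> vector_fields"
  shows "coefficient X \<xi> \<in> smooth_functions"
proof -
  have "smooth_G (\<lambda>a. gmul (gmul a (X a)) (star a) \<bullet> \<xi>)"
    by (intro smooth_G_linear[OF bounded_linear_inner_left] smooth_G_bilinear[OF bounded_bilinear_gmul]
        smooth_G_linear[OF bounded_linear_star] smooth_G_ident vector_fieldsD(1) X)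
  then have "smooth_G (coefficient X \<xi>)"
    by (rule smooth_G_cong[rotated]) (simp add: coefficient_def ad_def)
  moreover have "coefficient X \<xi> (gmul a h) = coefficient X \<xi> a" if "a \<in> G" "h \<in> H" for a h
  proof -
    have "h \<in> G" "gmul a h \<in> G"
      using that gmul_in_G H_subset_G by blast+
    then show ?thesis
      using that by (simp add: coefficient_def vector_fieldsD(4)[OF X] ad_gmul ad_star_cancel)
  qed
  ultimately show ?thesis
    by (simp add: smooth_functions_def coefficient_def)
qed

lemma generator_at:
  assumes "a \<in> G" "x \<in> \<mm>"
  shows "generator (ad a x) a = x"
  using assms by (simp add: generator_def ad_star_cancel proj_id)

lemma linear_generator: "linear (\<lambda>\<xi>. generator \<xi> a)"
  by (rule linearI)
     (simp_all add: generator_def linear_add[OF linear_ad] linear_scale[OF linear_ad] linear_add[OF linear_proj] linear_scale[OF linear_proj])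

text \<open>Expand \<open>ad a (X a)\<close> in the standard basis of the ambient space and
  transport back, using linearity of the generator in its matrix argument. The expansion is global,
  so neither local frames nor cutoff functions enter.\<close>

lemma generator_expansion:
  assumes X: "X \<in> vector_fields"
  shows "X = (\<lambda>a. \<Sum>\<xi>\<in>Basis. coefficient X \<xi> a *\<^sub>R generator \<xi> a)"
proof
  fix a
  show "X a = (\<Sum>\<xi>\<in>Basis. coefficient X \<xi> a *\<^sub>R generator \<xi> a)"
  proof (cases "a \<in> G")
    case True
    have "X a = generator (\<Sum>\<xi>\<in>Basis. (ad a (X a) \<bullet> \<xi>) *\<^sub>R \<xi>) a"
      using generator_at[OF True vector_fieldsD(3)[OF X]] by (simp only: euclidean_representation)
    also have "\<dots> = (\<Sum>\<xi>\<in>Basis. (ad a (X a) \<bullet> \<xi>) *\<^sub>R generator \<xi> a)"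
      by (simp only: linear_sum[OF linear_generator] linear_scale[OF linear_generator])
    finally show ?thesis
      using True by (simp add: coefficient_def)
  next
    case False
    then show ?thesis
      using vector_fieldsD(2)[OF X] by (simp add: coefficient_def)
  qed
qed

section \<open>Tensorial maps and their values at a point\<close>

lemma vector_fields_add:
  assumes X: "X \<in> vector_fields" and Y: "Y \<in> vector_fields"
  shows "(\<lambda>a. X a + Y a) \<in> vector_fields"
  using vector_fieldsD[OF X] vector_fieldsD[OF Y]
  by (intro vector_fieldsI) (simp_all add: smooth_G_add subspace_add[OF subspace_m] linear_add[OF linear_ad])

lemma vector_fields_scale:
  assumes f: "f \<in> smooth_functions" and X: "X \<in> vector_fields"
  shows "(\<lambda>a. f a *\<^sub>R X a) \<in> vector_fields"
  using vector_fieldsD[OF X] f smooth_G_bilinear[OF bounded_bilinear_scaleR, of f X]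
  by (intro vector_fieldsI) (simp_all add: smooth_functions_def subspace_scale[OF subspace_m] linear_scale[OF linear_ad])

lemma zero_vector_field: "(\<lambda>a. 0) \<in> vector_fields"
  by (rule vector_fieldsI) (simp_all add: smooth_G_const subspace_0[OF subspace_m] linear_0[OF linear_ad])

definition tensorial :: "((mat_pair \<Rightarrow> mat_pair) \<Rightarrow> mat_pair \<Rightarrow> mat_pair) \<Rightarrow> bool" where
  "tensorial L \<longleftrightarrow>
     (\<forall>X\<in>vector_fields. \<forall>Y\<in>vector_fields. L (\<lambda>a. X a + Y a) = (\<lambda>a. L X a + L Y a)) \<and>
     (\<forall>f\<in>smooth_functions. \<forall>X\<in>vector_fields. L (\<lambda>a. f a *\<^sub>R X a) = (\<lambda>a. f a *\<^sub>R L X a))"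

lemma tensorial_expansion:
  assumes L: "tensorial L" and X: "X \<in> vector_fields"
  shows "L X = (\<lambda>a. \<Sum>\<xi>\<in>Basis. coefficient X \<xi> a *\<^sub>R L (generator \<xi>) a)"
proof -
  have add: "L (\<lambda>a. Y a + Z a) = (\<lambda>a. L Y a + L Z a)" if "Y \<in> vector_fields" "Z \<in> vector_fields" for Y Z
    using L that by (simp add: tensorial_def)
  have scale: "L (\<lambda>a. f a *\<^sub>R Y a) = (\<lambda>a. f a *\<^sub>R L Y a)" if "f \<in> smooth_functions" "Y \<in> vector_fields" for f Y
    using L that by (simp add: tensorial_def)
  note summand = vector_fields_scale[OF coefficient_smooth_function[OF X] generator_vector_field]
  \<comment> \<open>Membership is part of the induction claim because additivity of \<open>L\<close>
    is known only for vector fields.\<close>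
  have "(\<lambda>a. \<Sum>\<xi>\<in>B. coefficient X \<xi> a *\<^sub>R generator \<xi> a) \<in> vector_fields \<and>
      L (\<lambda>a. \<Sum>\<xi>\<in>B. coefficient X \<xi> a *\<^sub>R generator \<xi> a) =
      (\<lambda>a. \<Sum>\<xi>\<in>B. coefficient X \<xi> a *\<^sub>R L (generator \<xi>) a)" if "finite B" for B
    using that
  proof induction
    case empty
    have "L (\<lambda>a. 0) = (\<lambda>a. L (\<lambda>a. 0) a + L (\<lambda>a. 0) a)"
      using add[OF zero_vector_field zero_vector_field] by simp
    then have "L (\<lambda>a. 0) = (\<lambda>a. 0)"
      by (simp add: fun_eq_iff)
    then show ?case
      by (simp add: zero_vector_field)
  next
    case (insert \<xi> B)
    then show ?case
      using vector_fields_add[OF summand] add[OF summand] scale[OF coefficient_smooth_function[OF X] generator_vector_field]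
      by simp
  qed
  from this[OF finite_Basis] show ?thesis
    using generator_expansion[OF X] by simp
qed

text \<open>The expansion in generators shows that \<open>L X a\<close> is a linear function of
  \<open>X a\<close> alone, so eight fields whose values at \<open>a\<close> are the basis suffice
  to test it.\<close>

lemma tensorial_eq_0:
  assumes L: "tensorial L" and a: "a \<in> G" and X: "X \<in> vector_fields"
    and 0: "\<And>i. i \<in> {1..8} \<Longrightarrow> L (generator (ad a (e i))) a = 0"
  shows "L X a = 0"
proof -
  define l where "l x = (\<Sum>\<xi>\<in>Basis. (ad a x \<bullet> \<xi>) *\<^sub>R L (generator \<xi>) a)" for x
  have l: "L Y a = l (Y a)" if "Y \<in> vector_fields" for Y
    using tensorial_expansion[OF L that] a by (simp add: coefficient_def l_def)
  have "linear l"
    by (rule linearI)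
       (simp_all add: l_def linear_add[OF linear_ad] linear_scale[OF linear_ad] inner_add_left scaleR_add_left
         sum.distrib scaleR_sum_right)
  moreover have "l (e i) = 0" if "i \<in> {1..8}" for i
    using 0[OF that] l[OF generator_vector_field] generator_at[OF a e_in_m[OF that]] by simp
  ultimately have "l x = 0" if "x \<in> \<mm>" for x
    using that linear_eq_0_on_span[of l "e ` {1..8}" x] unfolding \<mm>_def by blast
  then show ?thesis
    using l[OF X] vector_fieldsD(3)[OF X] by simp
qed

text \<open>The derivative of the tensor along \<open>W\<close> is the same for both connections and
  cancels, leaving a purely algebraic identity at the point.\<close>

lemma parallel_compare:
  assumes "parallel D r (invariant_tensor \<phi>)" "parallel D' r (invariant_tensor \<phi>)"
    and "W \<in> vector_fields" "length Xs = r" "set Xs \<subseteq> vector_fields" "a \<in> G"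
  shows "(\<Sum>l<r. \<phi> ((map (\<lambda>X. X a) Xs)[l := D W (Xs ! l) a])) = (\<Sum>l<r. \<phi> ((map (\<lambda>X. X a) Xs)[l := D' W (Xs ! l) a]))"
proof -
  have "cov_deriv D W (invariant_tensor \<phi>) Xs a = cov_deriv D' W (invariant_tensor \<phi>) Xs a"
    using assms by (simp add: parallel_def)
  then show ?thesis
    using assms(4) by (simp add: cov_deriv_def invariant_tensor_def map_update)
qed

section \<open>Comparison of characteristic connections\<close>

lemma lessThan_4: "{..<4::nat} = {0, 1, 2, 3}"
  by auto

lemma characteristic_connection_unique:
  assumes D: "characteristic_connection \<Phi> std_metric D"
    and X: "X \<in> vector_fields" and Y: "Y \<in> vector_fields"
  shows "D X Y = canonical_connection X Y"
proof
  fix a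
  let ?C = canonical_connection
  note C = characteristic_canonical
  have conn: "is_connection D" "is_connection ?C"
    using D C by (simp_all add: characteristic_connection_def)
  have char: "parallel D 2 (invariant_tensor std_metric)" "parallel ?C 2 (invariant_tensor std_metric)"
      "parallel D 4 (invariant_tensor \<Phi>)" "parallel ?C 4 (invariant_tensor \<Phi>)"
      "skew_torsion std_metric D" "skew_torsion std_metric ?C"
    using D C by (simp_all add: characteristic_connection_def)
  have vf: "D X Y \<in> vector_fields" "?C X Y \<in> vector_fields" if "X \<in> vector_fields" "Y \<in> vector_fields" for X Y
    using conn that by (simp_all add: is_connection_def)
  show "D X Y a = ?C X Y a"
  proof (cases "a \<in> G")
    case False
    then show ?thesis
      using vector_fieldsD(2)[OF vf(1)[OF X Y]] vector_fieldsD(2)[OF vf(2)[OF X Y]] by simp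
  next
    case a: True
    \<comment> \<open>The derivative terms in the Leibniz rules cancel, so the difference is
      tensorial in its second argument as well as in the first.\<close>
    define A where "A X Y = (\<lambda>a. D X Y a - ?C X Y a)" for X Y
    have tensorial_left: "tensorial (\<lambda>X. A X Y)" if "Y \<in> vector_fields" for Y
      unfolding tensorial_def A_def
    proof (intro conjI ballI ext)
      fix X X' a assume "X \<in> vector_fields" "X' \<in> vector_fields"
      then have "D (\<lambda>a. X a + X' a) Y = (\<lambda>a. D X Y a + D X' Y a)" "?C (\<lambda>a. X a + X' a) Y = (\<lambda>a. ?C X Y a + ?C X' Y a)"
        using conn that by (simp_all add: is_connection_def)
      then show "D (\<lambda>a. X a + X' a) Y a - ?C (\<lambda>a. X a + X' a) Y a = D X Y a - ?C X Y a + (D X' Y a - ?C X' Y a)"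
        by simp
    next
      fix f X a assume "f \<in> smooth_functions" "X \<in> vector_fields"
      then have "D (\<lambda>a. f a *\<^sub>R X a) Y = (\<lambda>a. f a *\<^sub>R D X Y a)" "?C (\<lambda>a. f a *\<^sub>R X a) Y = (\<lambda>a. f a *\<^sub>R ?C X Y a)"
        using conn that by (simp_all add: is_connection_def)
      then show "D (\<lambda>a. f a *\<^sub>R X a) Y a - ?C (\<lambda>a. f a *\<^sub>R X a) Y a = f a *\<^sub>R (D X Y a - ?C X Y a)"
        by (simp add: scaleR_diff_right)
    qed
    have tensorial_right: "tensorial (A X)" if "X \<in> vector_fields" for X
      unfolding tensorial_def A_def
    proof (intro conjI ballI ext)
      fix Y Y' a assume "Y \<in> vector_fields" "Y' \<in> vector_fields"
      then have "D X (\<lambda>a. Y a + Y' a) = (\<lambda>a. D X Y a + D X Y' a)" "?C X (\<lambda>a. Y a + Y' a) = (\<lambda>a. ?C X Y a + ?C X Y' a)"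
        using conn that by (simp_all add: is_connection_def)
      then show "D X (\<lambda>a. Y a + Y' a) a - ?C X (\<lambda>a. Y a + Y' a) a = D X Y a - ?C X Y a + (D X Y' a - ?C X Y' a)"
        by simp
    next
      fix f Y a assume "f \<in> smooth_functions" "Y \<in> vector_fields"
      then have "D X (\<lambda>a. f a *\<^sub>R Y a) = (\<lambda>a. along X f a *\<^sub>R Y a + f a *\<^sub>R D X Y a)"
          "?C X (\<lambda>a. f a *\<^sub>R Y a) = (\<lambda>a. along X f a *\<^sub>R Y a + f a *\<^sub>R ?C X Y a)"
        using conn that by (simp_all add: is_connection_def)
      then show "D X (\<lambda>a. f a *\<^sub>R Y a) a - ?C X (\<lambda>a. f a *\<^sub>R Y a) a = f a *\<^sub>R (D X Y a - ?C X Y a)"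
        by (simp add: scaleR_diff_right)
    qed
    define E where "E i = generator (ad a (e i))" for i
    have E: "E i \<in> vector_fields" for i
      by (simp add: E_def generator_vector_field)
    have Ea: "E i a = e i" if "i \<in> {1..8}" for i
      using that by (simp add: E_def generator_at[OF a])
    have m: "D (E i) (E j) a \<in> \<mm>" "?C (E i) (E j) a \<in> \<mm>" for i j
      by (rule vector_fieldsD(3)[OF vf(1)[OF E E]], rule vector_fieldsD(3)[OF vf(2)[OF E E]])
    define b where "b i j k = coord k (A (E i) (E j) a)" for i j k
    have b: "b i j k = coord k (D (E i) (E j) a) - coord k (?C (E i) (E j) a)" for i j k
      by (simp add: b_def A_def coord_simps)
    have skew_23: "b i j k = - b i k j" if "i \<in> {1..8}" "j \<in> {1..8}" "k \<in> {1..8}" for i j k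
    proof -
      have "(\<Sum>l<2. std_metric ((map (\<lambda>X. X a) [E j, E k])[l := D (E i) ([E j, E k] ! l) a])) =
          (\<Sum>l<2. std_metric ((map (\<lambda>X. X a) [E j, E k])[l := ?C (E i) ([E j, E k] ! l) a]))"
        by (rule parallel_compare[OF char(1,2) E _ _ a]) (simp_all add: E)
      then show ?thesis
        using that by (simp add: b lessThan_2 One_nat_def Ea[unfolded One_nat_def] std_metric_e[unfolded One_nat_def] m)
    qed
    have skew_tor: "b i j k - b j i k = - (b i k j - b k i j)" if "i \<in> {1..8}" "j \<in> {1..8}" "k \<in> {1..8}" for i j k
    proof -
      \<comment> \<open>Solving the torsion formula of the canonical connection for the bracket
        places it in \<open>\<mm>\<close>, where the metric with \<open>e k\<close> reads off a
        coordinate.\<close>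
      have bracket: "lie_bracket (E i) (E j) a \<in> \<mm>" for i j
      proof -
        have "lie_bracket (E i) (E j) a = ?C (E i) (E j) a - ?C (E j) (E i) a - proj (bracket (E i a) (E j a))"
          using torsion_canonical[OF E E a, of i j] by (simp add: torsion_def algebra_simps)
        then show ?thesis
          using m(2) by (simp add: subspace_diff[OF subspace_m])
      qed
      have t: "torsion_tensor std_metric D' [E i, E j, E k] a =
          coord k (D' (E i) (E j) a) - coord k (D' (E j) (E i) a) - coord k (lie_bracket (E i) (E j) a)"
        if "D' = D \<or> D' = ?C" "k \<in> {1..8}" for D' i j k
      proof -
        have "torsion D' (E i) (E j) a \<in> \<mm>"
          unfolding torsion_def using that m bracket by (intro subspace_diff[OF subspace_m]) auto
        then show ?thesis
          using that(2) by (simp add: torsion_tensor_def Ea std_metric_e) (simp add: torsion_def coord_simps)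
      qed
      have "torsion_tensor std_metric D [E i, E j, E k] a = - torsion_tensor std_metric D [E i, E k, E j] a"
        "torsion_tensor std_metric ?C [E i, E j, E k] a = - torsion_tensor std_metric ?C [E i, E k, E j] a"
        using char(5,6) E a unfolding skew_torsion_def by blast+
      then show ?thesis
        using that by (simp add: t b)
    qed
    \<comment> \<open>Given \<open>skew_23\<close>, one side of \<open>skew_tor\<close> cancels and
      what remains is skewness in the first and third indices; together these generate all
      transpositions.\<close>
    have skew_12: "b i j k = - b j i k" if "i \<in> {1..8}" "j \<in> {1..8}" "k \<in> {1..8}" for i j k
      using skew_tor[OF that] skew_tor[OF that(2,3,1)] skew_tor[OF that(3,1,2)]
        skew_23[OF that] skew_23[OF that(2,3,1)] skew_23[OF that(3,1,2)] by linarith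
    \<comment> \<open>The difference of the two sides says that the endomorphism given by
      \<open>A (E i)\<close> at \<open>a\<close> annihilates \<open>\<Phi>\<close> as a
      derivation.\<close>
    have inv: "\<Phi> [D (E i) (E p) a, e q, e r, e s] + \<Phi> [e p, D (E i) (E q) a, e r, e s]
          + \<Phi> [e p, e q, D (E i) (E r) a, e s] + \<Phi> [e p, e q, e r, D (E i) (E s) a] =
        \<Phi> [?C (E i) (E p) a, e q, e r, e s] + \<Phi> [e p, ?C (E i) (E q) a, e r, e s]
          + \<Phi> [e p, e q, ?C (E i) (E r) a, e s] + \<Phi> [e p, e q, e r, ?C (E i) (E s) a]"
      if "{p, q, r, s} \<subseteq> {1..8}" for i p q r s
    proof -
      let ?Xs = "[E p, E q, E r, E s]"
      have "(\<Sum>l<4. \<Phi> ((map (\<lambda>X. X a) ?Xs)[l := D (E i) (?Xs ! l) a])) =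
          (\<Sum>l<4. \<Phi> ((map (\<lambda>X. X a) ?Xs)[l := ?C (E i) (?Xs ! l) a]))"
        by (rule parallel_compare[OF char(3,4) E _ _ a]) (simp_all add: E)
      then show ?thesis
        using that by (simp add: lessThan_4 One_nat_def numeral_2_eq_2 numeral_3_eq_3 Ea[unfolded One_nat_def])
    qed
    have "b i j k = 0" if "i \<in> {1..8}" "j \<in> {1..8}" "k \<in> {1..8}" for i j k
      using skew_23 skew_12 _ _ _ _ _ _ _ that
    proof (rule three_form_eq_0_if_contractions_in_spin7)
      fix i
      note \<Phi>D = \<Phi>_derivation[where u = "\<lambda>j. D (E i) (E j) a", OF m(1)]
      note \<Phi>C = \<Phi>_derivation[where u = "\<lambda>j. ?C (E i) (E j) a", OF m(2)]
      show "b i 1 8 + b i 2 7 - b i 3 6 + b i 5 4 = 0"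
        "- b i 1 7 + b i 2 8 + b i 3 5 + b i 6 4 = 0"
        "b i 1 6 - b i 2 5 + b i 3 8 + b i 7 4 = 0"
        "- b i 1 5 - b i 2 6 - b i 3 7 + b i 8 4 = 0"
        "- b i 1 4 + b i 2 3 + b i 5 8 + b i 7 6 = 0"
        "b i 1 3 + b i 2 4 - b i 5 7 + b i 8 6 = 0"
        "- b i 1 2 + b i 3 4 + b i 5 6 + b i 8 7 = 0"
        unfolding b
        using inv[of 1 2 3 5 i] inv[of 1 2 3 6 i] inv[of 1 2 3 7 i] inv[of 1 2 3 8 i] inv[of 1 2 5 7 i] inv[of 1 2 5 8 i] inv[of 1 3 5 8 i]
        by (simp_all add: \<Phi>D \<Phi>C)
    qed
    then have "A (E i) (E j) a = 0" if "i \<in> {1..8}" "j \<in> {1..8}" for i j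
      using that m subspace_diff[OF subspace_m] subspace_0[OF subspace_m]
      by (intro eq_if_coord_eq) (auto simp: b_def A_def coord_simps(1))
    \<comment> \<open>Tensoriality extends the vanishing from the test fields one argument at a
      time: first the direction, then the differentiated field.\<close>
    then have "A X (E j) a = 0" if "j \<in> {1..8}" for j
      using that by (intro tensorial_eq_0[OF tensorial_left[OF E] a X]) (simp add: E_def)
    then have "A X Y a = 0"
      by (intro tensorial_eq_0[OF tensorial_right[OF X] a Y]) (simp add: E_def)
    then show ?thesis
      by (simp add: A_def)
  qed
qed

text \<open>The torsion tensor is identified with the constant form only on \<open>G\<close>.
  Functions that agree on \<open>G\<close> have the same derivatives within \<open>G\<close>, hence
  the same chosen one.\<close>

lemma along_cong:
  assumes eq: "\<And>b. b \<in> G \<Longrightarrow> f b = g b" and a: "a \<in> G"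
  shows "along W f a = along W g a"
proof -
  have "(f has_derivative D) (at a within G) \<longleftrightarrow> (g has_derivative D) (at a within G)" for D
    using has_derivative_transform[OF a, of g f] has_derivative_transform[OF a, of f g] eq by auto
  then show ?thesis
    by (simp add: along_def frechet_derivative_def)
qed

theorem corollary7p16:
  shows "invariant_spin7_structure \<Phi> \<and> induced_metric \<Phi> std_metric \<and>
    naturally_reductive std_metric \<and>
    characteristic_connection \<Phi> std_metric canonical_connection \<and>
    (\<forall>D. characteristic_connection \<Phi> std_metric D \<longrightarrow>
       (\<forall>X\<in>vector_fields. \<forall>Y\<in>vector_fields. D X Y = canonical_connection X Y) \<and>
       (\<forall>X\<in>vector_fields. \<forall>Y\<in>vector_fields. \<forall>Z\<in>vector_fields. \<forall>a\<in>G.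
          torsion_tensor std_metric D [X, Y, Z] a = torsion_3form [X a, Y a, Z a]) \<and>
       parallel D 3 (torsion_tensor std_metric D))"
proof (intro conjI allI impI)
  fix D assume "characteristic_connection \<Phi> std_metric D"
  then have D: "D X Y = canonical_connection X Y" if "X \<in> vector_fields" "Y \<in> vector_fields" for X Y
    using that by (rule characteristic_connection_unique)
  then show "\<forall>X\<in>vector_fields. \<forall>Y\<in>vector_fields. D X Y = canonical_connection X Y"
    by simp
  have T: "torsion_tensor std_metric D [X, Y, Z] a = torsion_3form [X a, Y a, Z a]"
    if "X \<in> vector_fields" "Y \<in> vector_fields" "Z \<in> vector_fields" "a \<in> G" for X Y Z a
    using torsion_tensor_canonical[OF that] that by (simp add: torsion_tensor_def torsion_def D)
  then show "\<forall>X\<in>vector_fields. \<forall>Y\<in>vector_fields. \<forall>Z\<in>vector_fields. \<forall>a\<in>G.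
      torsion_tensor std_metric D [X, Y, Z] a = torsion_3form [X a, Y a, Z a]"
    by simp
  have T': "torsion_tensor std_metric D Xs a = invariant_tensor torsion_3form Xs a"
    if Xs: "length Xs = 3" "set Xs \<subseteq> vector_fields" "a \<in> G" for Xs a
  proof -
    obtain X Y Z where "Xs = [X, Y, Z]"
      using Xs(1) by (auto simp: length_eq_3)
    then show ?thesis
      using Xs T[of X Y Z a] by (simp add: invariant_tensor_def)
  qed
  have "parallel canonical_connection 3 (invariant_tensor torsion_3form)"
    by (rule parallel_canonical[OF leibniz_torsion_3form torsion_3form_coord])
  then have C: "cov_deriv canonical_connection W (invariant_tensor torsion_3form) Xs a = 0"
    if "W \<in> vector_fields" "length Xs = 3" "set Xs \<subseteq> vector_fields" "a \<in> G" for W Xs a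
    using that by (simp add: parallel_def)
  show "parallel D 3 (torsion_tensor std_metric D)"
    unfolding parallel_def
  proof (intro ballI allI impI, elim conjE)
    fix W Xs a assume W: "W \<in> vector_fields" and Xs: "length Xs = 3" "set Xs \<subseteq> vector_fields" and a: "a \<in> G"
    \<comment> \<open>An arbitrary \<open>D\<close> is known only on vector fields, and all fields
      substituted here are of that kind; so each term of the covariant derivative becomes the one
      for the canonical connection.\<close>
    have "torsion_tensor std_metric D (Xs[i := D W (Xs ! i)]) a =
        invariant_tensor torsion_3form (Xs[i := canonical_connection W (Xs ! i)]) a" if "i < 3" for i
    proof -
      have Xi: "Xs ! i \<in> vector_fields"
        using that Xs nth_mem by fastforce
      then have "set (Xs[i := canonical_connection W (Xs ! i)]) \<subseteq> vector_fields"
        using Xs(2) canonical_connection_vector_field[OF W] by (intro set_update_subsetI) auto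
      then show ?thesis
        using T' Xs(1) a D[OF W Xi] by simp
    qed
    moreover have "along W (torsion_tensor std_metric D Xs) a = along W (invariant_tensor torsion_3form Xs) a"
      using T'[OF Xs] a by (intro along_cong) simp_all
    ultimately show "cov_deriv D W (torsion_tensor std_metric D) Xs a = 0"
      using C[OF W Xs a] Xs(1) by (simp add: cov_deriv_def)
  qed
qed (simp_all add: invariant_spin7_structure_\<Phi> induced_metric_\<Phi> naturally_reductive_std_metric characteristic_canonical)

end
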